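(* Let $\mathbb{F}$ be a field and $n\ge 1$. Any companion ULH matrix of order $n$ belongs to $\widetilde{\mathcal{C}}$. Moreover, if $A\in \widetilde{C}_{i_1,\ldots,i_n}$ then $A$ is a companion matrix if and only if the following conditions are met: (i) the constant part of $A$ is a nilpotent matrix; (ii) for each $k=1,\ldots,n$, $A[1,\ldots,i_k-k]$ is a constant nilpotent matrix or the empty matrix; (iii) for each $k=1,\ldots,n$, $A[i_k+1,\ldots,n]$ is a constant nilpotent matrix or the empty matrix. If the only nonzero entries of the $i_1$-block of $A$ are $x_1,\ldots,x_n$ then condition (i) can be omitted (that is, $A$ is companion if and only if (ii) and (iii) hold).
   Context: $\mathbb{F}$ is a field and $x_1,\ldots,x_n$ are variables (independent indeterminates). A matrix $A$ of order $n$ is companion if: $n^2-n$ of its entries are constants of $\mathbb{F}$; the $n$ remaining entries are the variables $x_1,\ldots,x_n$ (each appearing once); and $\det(\lambda I_n-A)=\lambda^n-x_1\lambda^{n-1}-\cdots-x_{n-1}\lambda-x_n$. A square matrix is unit lower Hessenberg (ULH) if all superdiagonal entries equal $1$ and all entries above the superdiagonal are $0$. A companion ULH matrix is a companion matrix that is also ULH. For integers $i_1,\ldots,i_n$ with $k\le i_k\le n$ and $i_k-k+1\le i_1\le i_k$ for all $k=1,\ldots,n$, let $C_{i_1,\ldots,i_n}$ be the ULH matrix of order $n$ whose $(i_k,i_k-k+1)$ entry is $x_k$ for $k=1,\ldots,n$ and all of whose other entries on or below the main diagonal are $0$. $\mathcal{C}$ is the set of all such matrices (of any order $n$). A ULH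 superpattern of a ULH matrix $M$ is a matrix obtained from $M$ by changing some (possibly none) of the zero entries of $M$ below the superdiagonal (i.e. on or below the main diagonal) to nonzero constants of $\mathbb{F}$. $\widetilde{C}_{i_1,\ldots,i_n}$ is the set of all ULH superpatterns of $C_{i_1,\ldots,i_n}$, and $\widetilde{\mathcal{C}}$ is the set of all ULH superpatterns of all matrices of $\mathcal{C}$. The constant part of $A$ is the matrix obtained by setting $x_1=\cdots=x_n=0$. $A[i,\ldots,j]$ is the principal submatrix of $A$ on rows and columns $i,\ldots,j$; it is the empty matrix (order $0$) if $i,\ldots,j$ is not a valid range. The $i_1$-block of $A$ is the submatrix of rows $i_1,\ldots,n$ and columns $1,\ldots,i_1$. *)

theory Defs
  imports
    "HOL-Library.Poly_Mapping"
    "Jordan_Normal_Form.Char_Poly"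
    "Jordan_Normal_Form.DL_Submatrix"
begin

(* 'a mpoly is the polynomial ring over 'a in indeterminates x_0, x_1, x_2, ...: finitely
   supported coefficient functions on monomials, a monomial being a finitely supported exponent
   function.  A matrix of order n uses the indeterminates x_1, ..., x_n only. *)
type_synonym 'a mpoly = "(nat \<Rightarrow>\<^sub>0 nat) \<Rightarrow>\<^sub>0 'a"

definition mconst :: "'a \<Rightarrow> 'a::zero mpoly" where
  "mconst c = Poly_Mapping.single 0 c"

definition mvar :: "nat \<Rightarrow> 'a::zero_neq_one mpoly" where
  "mvar k = Poly_Mapping.single (Poly_Mapping.single k 1) 1"

definition meval :: "(nat \<Rightarrow> 'a) \<Rightarrow> 'a::comm_semiring_1 mpoly \<Rightarrow> 'a" where
  "meval \<rho> p = (\<Sum>m\<in>Poly_Mapping.keys p.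
     Poly_Mapping.lookup p m * (\<Prod>v\<in>Poly_Mapping.keys m. \<rho> v ^ Poly_Mapping.lookup m v))"

(* Matrices are indexed from 0: the entry in row i and column j of the mathematical
   (1-based) numbering is A $$ (i - 1, j - 1). *)

definition companion_mat :: "nat \<Rightarrow> 'a::comm_ring_1 mpoly mat \<Rightarrow> bool" where
  "companion_mat n A \<longleftrightarrow>
     A \<in> carrier_mat n n \<and>
     (\<exists>pos. inj_on pos {1..n} \<and> pos ` {1..n} \<subseteq> {0..<n} \<times> {0..<n} \<and>
        (\<forall>k\<in>{1..n}. A $$ pos k = mvar k) \<and>
        (\<forall>p\<in>{0..<n} \<times> {0..<n} - pos ` {1..n}. \<exists>c. A $$ p = mconst c)) \<and>
     char_poly A = monom 1 n - (\<Sum>k=1..n. monom (mvar k) (n - k))"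

definition ULH :: "'a::{zero,one} mat \<Rightarrow> bool" where
  "ULH A \<longleftrightarrow> square_mat A \<and>
     (\<forall>i<dim_row A. \<forall>j<dim_row A.
        (j = i + 1 \<longrightarrow> A $$ (i, j) = 1) \<and> (j > i + 1 \<longrightarrow> A $$ (i, j) = 0))"

definition valid_indices :: "nat \<Rightarrow> (nat \<Rightarrow> nat) \<Rightarrow> bool" where
  "valid_indices n ix \<longleftrightarrow> 1 \<le> n \<and>
     (\<forall>k\<in>{1..n}. k \<le> ix k \<and> ix k \<le> n \<and> ix k - k + 1 \<le> ix 1 \<and> ix 1 \<le> ix k)"

(* On or below the diagonal, the 1-based position (i, j) = (r + 1, c + 1) equals
   (ix k, ix k - k + 1) for some k iff k = i - j + 1 = r - c + 1 and ix k = i = r + 1. *)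
definition C_mat :: "nat \<Rightarrow> (nat \<Rightarrow> nat) \<Rightarrow> 'a::comm_ring_1 mpoly mat" where
  "C_mat n ix = mat n n (\<lambda>(r, c).
     if c = r + 1 then 1
     else if c > r then 0
     else if ix (r - c + 1) = r + 1 then mvar (r - c + 1)
     else 0)"

lemma C_mat_var:
  assumes "valid_indices n ix" "k \<in> {1..n}"
  shows "C_mat n ix $$ (ix k - 1, (ix k - k + 1) - 1) = mvar k"
proof -
  have "1 \<le> k" "k \<le> ix k" "ix k \<le> n"
    using assms by (auto simp: valid_indices_def)
  moreover from this have "Suc (ix k - Suc 0 - (ix k - k)) = k" "Suc (ix k - Suc 0) = ix k"
    by linarith+
  ultimately show ?thesis
    by (auto simp: C_mat_def)
qed

lemma C_mat_zero:
  assumes "r < n" "c \<le> r" "\<forall>k\<in>{1..n}. (r + 1, c + 1) \<noteq> (ix k, ix k - k + 1)"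
  shows "C_mat n ix $$ (r, c) = 0"
proof -
  have "ix (r - c + 1) \<noteq> r + 1"
    using assms by (auto dest!: bspec[where x = "r - c + 1"])
  thus ?thesis using assms by (simp add: C_mat_def)
qed

definition C_class :: "'a::comm_ring_1 mpoly mat set" where
  "C_class = {C_mat n ix | n ix. valid_indices n ix}"

definition ULH_superpatterns :: "'a::comm_ring_1 mpoly mat \<Rightarrow> 'a mpoly mat set" where
  "ULH_superpatterns M = {A. A \<in> carrier_mat (dim_row M) (dim_col M) \<and>
     (\<forall>i<dim_row M. \<forall>j<dim_col M.
        A $$ (i, j) = M $$ (i, j) \<or>
        (j \<le> i \<and> M $$ (i, j) = 0 \<and> (\<exists>c. c \<noteq> 0 \<and> A $$ (i, j) = mconst c)))}"

definition C_tilde_class :: "'a::comm_ring_1 mpoly mat set" where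
  "C_tilde_class = (\<Union>M\<in>C_class. ULH_superpatterns M)"

definition constant_part :: "'a::comm_semiring_1 mpoly mat \<Rightarrow> 'a mat" where
  "constant_part A = map_mat (meval (\<lambda>_. 0)) A"

definition constant_mat :: "'a::zero mpoly mat \<Rightarrow> bool" where
  "constant_mat A \<longleftrightarrow> (\<forall>i<dim_row A. \<forall>j<dim_col A. \<exists>c. A $$ (i, j) = mconst c)"

definition nilpotent_mat :: "'a::semiring_1 mat \<Rightarrow> bool" where
  "nilpotent_mat A \<longleftrightarrow> square_mat A \<and> (\<exists>m. A ^\<^sub>m m = 0\<^sub>m (dim_row A) (dim_row A))"

(* A[i,...,j] for 1-based i and j *)
definition principal_submatrix :: "'a mat \<Rightarrow> nat \<Rightarrow> nat \<Rightarrow> 'a mat" where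
  "principal_submatrix A i j =
     submatrix A {r. i \<le> r + 1 \<and> r + 1 \<le> j} {r. i \<le> r + 1 \<and> r + 1 \<le> j}"

definition empty_mat :: "'a mat \<Rightarrow> bool" where
  "empty_mat A \<longleftrightarrow> dim_row A = 0 \<and> dim_col A = 0"

(* rows p, ..., n and columns 1, ..., p in the 1-based numbering, for A of order n *)
definition corner_block :: "'a mat \<Rightarrow> nat \<Rightarrow> 'a mat" where
  "corner_block A p = submatrix A {r. p \<le> r + 1} {c. c + 1 \<le> p}"

end

theory Submission
  imports Defs
begin

text \<open>
  The characteristic polynomial of a unit lower Hessenberg matrix \<open>A\<close> of order
  \<open>n\<close> is a sum over the increasing paths from \<open>0\<close> to \<open>n\<close>,
  if \<open>X\<close> is the indeterminate and the entry of \<open>X - A\<close> in row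
  \<open>r\<close> and column \<open>c \<le> r\<close> (counted from 0) is read as the weight of a
  step from \<open>c\<close> to \<open>r + 1\<close> (\<open>path_sum\<close>,
  \<open>det_hessenberg\<close>). Two observations about paths carry the whole proof.

  A path through a variable \<open>x\<^sub>k\<close> in row \<open>r\<close> and column
  \<open>c\<close> splits into a path ending at \<open>c\<close> and a path starting at \<open>r +
  1\<close>. Hence the coefficient of \<open>x\<^sub>k\<close> in the characteristic polynomial is
  \<open>- L * R\<close>, where \<open>L\<close> and \<open>R\<close> are the characteristic
  polynomials of the principal blocks before column \<open>c\<close> and after row
  \<open>r\<close> (\<open>coefficient_of_variable\<close>). In a companion matrix \<open>L *
  R\<close> is the power of the indeterminate with exponent \<open>n - k\<close>, and since both
  factors are monic over a domain, each is itself a power of the indeterminate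
  (\<open>companion_blocks_monom\<close>). The exponents put \<open>x\<^sub>k\<close> on
  subdiagonal number \<open>k - 1\<close>. In particular \<open>L\<close> and \<open>R\<close>
  contain no variable; so the diagonal position of \<open>x\<^sub>1\<close> lies in neither of the
  two blocks, which gives the inequalities between the indices and the membership in the class of
  superpatterns (\<open>companion_ULH_in_C_tilde_class\<close>).

  Conversely, in a superpattern all variables lie in the block of rows \<open>i\<^sub>1, ...,
  n\<close> and columns \<open>1, ..., i\<^sub>1\<close>. Every path crosses this block in exactly
  one step (\<open>path_sum_crossing\<close>), so no product of two variables occurs, and the
  characteristic polynomial is that of the constant part minus the sum of the terms
  \<open>x\<^sub>k * L * R\<close> (\<open>char_poly_layout_expansion\<close>). Comparing
  coefficients, \<open>A\<close> is companion iff the constant part and all these blocks have a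
  power of the indeterminate as characteristic polynomial, and over a domain this means nilpotency
  (\<open>nilpotent_iff_char_poly\<close>). If the constant part vanishes on the corner block,
  then only the diagonal step at \<open>i\<^sub>1\<close> can cross it, and the conditions for
  \<open>k = 1\<close> imply that the constant part is nilpotent
  (\<open>char_poly_zero_corner\<close>).
\<close>

section \<open>Hessenberg determinants as sums over paths\<close>

text \<open>
  The matrix entry in row \<open>r\<close> and column \<open>c \<le> r\<close> (counted from 0) is
  read as a step from \<open>c\<close> to \<open>r + 1\<close> of weight \<open>b r c\<close>.
  With this reading \<open>path_sum b i j\<close> is the sum, over all strictly increasing paths
  from \<open>i\<close> to \<open>j\<close>, of the product of the weights of the steps; the
  recursion splits off the last step. The value 1 for \<open>j < i\<close> is arbitrary.
\<close>

function path_sum :: "(nat \<Rightarrow> nat \<Rightarrow> 'r::comm_ring_1) \<Rightarrow> nat \<Rightarrow> nat \<Rightarrow> 'r" where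
  "path_sum b i j = (if j \<le> i then 1 else \<Sum>c\<in>{i..<j}. path_sum b i c * b (j - 1) c)"
  by auto
termination by (relation "measure (\<lambda>(b, i, j). j)") auto

declare path_sum.simps [simp del]

lemma path_sum_le [simp]: "j \<le> i \<Longrightarrow> path_sum b i j = 1"
  by (subst path_sum.simps) simp

lemma path_sum_Suc:
  "i \<le> j \<Longrightarrow> path_sum b i (Suc j) = (\<Sum>c\<in>{i..j}. path_sum b i c * b j c)"
  by (subst path_sum.simps) (simp add: atLeastLessThanSuc_atLeastAtMost)

lemma path_sum_cong:
  assumes "\<And>r c. i \<le> c \<Longrightarrow> c \<le> r \<Longrightarrow> r < j \<Longrightarrow> b r c = b' r c"
  shows "path_sum b i j = path_sum b' i j"
  using assms
proof (induction j rule: less_induct)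
  case (less j)
  show ?case
  proof (cases "j \<le> i")
    case False
    then obtain m where m: "j = Suc m" "i \<le> m" by (cases j) auto
    have "path_sum b i c * b m c = path_sum b' i c * b' m c" if "c \<in> {i..m}" for c
      using less.IH[of c] less.prems[of c m] less.prems that m by (auto simp: less_Suc_eq_le)
    then show ?thesis using m by (simp add: path_sum_Suc)
  qed simp
qed

lemma path_sum_closed:
  assumes "\<And>r c. i \<le> c \<Longrightarrow> c \<le> r \<Longrightarrow> r < j \<Longrightarrow> b r c \<in> S"
    and "0 \<in> S" "1 \<in> S"
    and add: "\<And>x y. x \<in> S \<Longrightarrow> y \<in> S \<Longrightarrow> x + y \<in> S"
    and mult: "\<And>x y. x \<in> S \<Longrightarrow> y \<in> S \<Longrightarrow> x * y \<in> S"
  shows "path_sum b i j \<in> S"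
  using assms(1)
proof (induction j rule: less_induct)
  case (less j)
  have sum_closed: "sum f I \<in> S" if "\<And>c. c \<in> I \<Longrightarrow> f c \<in> S" for f and I :: "nat set"
    using that by (induction I rule: infinite_finite_induct) (auto intro: add assms(2))
  show ?case
  proof (cases "j \<le> i")
    case False
    then obtain m where m: "j = Suc m" "i \<le> m" by (cases j) auto
    have "path_sum b i c * b m c \<in> S" if "c \<in> {i..m}" for c
      using less.IH[of c] less.prems[of c m] less.prems that m by (auto intro!: mult)
    then have "(\<Sum>c\<in>{i..m}. path_sum b i c * b m c) \<in> S" by (rule sum_closed)
    then show ?thesis using m by (simp add: path_sum_Suc)
  qed (simp add: assms(3))
qed

text \<open>
  Every path from \<open>i\<close> to \<open>j\<close> contains exactly one step that starts at or
  before \<open>s\<close> and ends after \<open>s\<close>. This is the only place where the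
  combinatorics of paths is used: in matrix terms the crossing steps are the entries of the block
  of rows from \<open>s\<close> on and columns up to \<open>s\<close>, and no path uses two of
  them.
\<close>

lemma path_sum_crossing:
  assumes "i \<le> s" "s < j"
  shows "path_sum b i j =
    (\<Sum>c\<in>{i..s}. \<Sum>r\<in>{s..<j}. path_sum b i c * b r c * path_sum b (Suc r) j)"
  using assms(2)
proof (induction j rule: less_induct)
  case (less j)
  then obtain m where m: "j = Suc m" "s \<le> m" by (cases j) auto
  have swap: "(\<Sum>c'\<in>{Suc s..m}. \<Sum>r\<in>{s..<c'}. f r c') = (\<Sum>r\<in>{s..<m}. \<Sum>c'\<in>{Suc r..m}. f r c')"
    for f :: "nat \<Rightarrow> nat \<Rightarrow> 'a"
    by (simp add: sum.Sigma, rule sum.reindex_bij_witness[of _ prod.swap prod.swap]) auto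
  have "path_sum b i j = (\<Sum>c\<in>{i..m}. path_sum b i c * b m c)"
    using m assms(1) by (simp add: path_sum_Suc)
  also have "\<dots> = (\<Sum>c\<in>{i..s}. path_sum b i c * b m c) + (\<Sum>c'\<in>{Suc s..m}. path_sum b i c' * b m c')"
    by (subst sum.union_disjoint[symmetric]) (use m assms(1) in \<open>auto intro!: sum.cong\<close>)
  also have "(\<Sum>c'\<in>{Suc s..m}. path_sum b i c' * b m c') =
    (\<Sum>c'\<in>{Suc s..m}. \<Sum>c\<in>{i..s}. \<Sum>r\<in>{s..<c'}. path_sum b i c * b r c * path_sum b (Suc r) c' * b m c')"
  proof (rule sum.cong[OF refl])
    fix c' assume "c' \<in> {Suc s..m}"
    then have "path_sum b i c' =
      (\<Sum>c\<in>{i..s}. \<Sum>r\<in>{s..<c'}. path_sum b i c * b r c * path_sum b (Suc r) c')"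
      using less.IH[of c'] m by auto
    then show "path_sum b i c' * b m c' =
      (\<Sum>c\<in>{i..s}. \<Sum>r\<in>{s..<c'}. path_sum b i c * b r c * path_sum b (Suc r) c' * b m c')"
      by (simp add: sum_distrib_right)
  qed
  also have "\<dots> = (\<Sum>c\<in>{i..s}. \<Sum>r\<in>{s..<m}. \<Sum>c'\<in>{Suc r..m}.
      path_sum b i c * b r c * path_sum b (Suc r) c' * b m c')"
    by (subst sum.swap) (simp add: swap)
  also have "\<dots> = (\<Sum>c\<in>{i..s}. \<Sum>r\<in>{s..<m}. path_sum b i c * b r c * path_sum b (Suc r) j)"
    by (intro sum.cong refl) (auto simp: m path_sum_Suc sum_distrib_left mult.assoc)
  also have "(\<Sum>c\<in>{i..s}. path_sum b i c * b m c) + \<dots> =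
     (\<Sum>c\<in>{i..s}. \<Sum>r\<in>{s..<j}. path_sum b i c * b r c * path_sum b (Suc r) j)"
    using m by (simp add: sum.distrib[symmetric] add.commute)
  finally show ?case .
qed

text \<open>
  A path sum depends affinely on the entries of a corner block. The two factors next to a changed
  entry only see entries outside the block, so they agree for \<open>b\<close> and
  \<open>b'\<close>.
\<close>

lemma path_sum_perturb:
  assumes "i \<le> s" "s < j"
    and eq: "\<And>r c. \<not> (c \<le> s \<and> s \<le> r) \<Longrightarrow> i \<le> c \<Longrightarrow> c \<le> r \<Longrightarrow> r < j \<Longrightarrow> b r c = b' r c"
  shows "path_sum b i j = path_sum b' i j +
    (\<Sum>c\<in>{i..s}. \<Sum>r\<in>{s..<j}. path_sum b i c * (b r c - b' r c) * path_sum b (Suc r) j)"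
proof -
  have L: "path_sum b i c = path_sum b' i c" if "c \<in> {i..s}" for c
    by (rule path_sum_cong) (use that assms in auto)
  have R: "path_sum b (Suc r) j = path_sum b' (Suc r) j" if "r \<in> {s..<j}" for r
    by (rule path_sum_cong) (use that assms in auto)
  have "path_sum b' i j =
     (\<Sum>c\<in>{i..s}. \<Sum>r\<in>{s..<j}. path_sum b i c * b' r c * path_sum b (Suc r) j)"
    unfolding path_sum_crossing[OF assms(1,2), of b'] by (intro sum.cong refl) (simp add: L R)
  then show ?thesis
    unfolding path_sum_crossing[OF assms(1,2), of b]
    by (simp add: algebra_simps sum.distrib[symmetric])
qed

lemma path_sum_perturb_single:
  assumes "i \<le> c" "c \<le> r" "r < j"
  shows "path_sum b i j = path_sum (\<lambda>r' c'. if r' = r \<and> c' = c then b r c - d else b r' c') i j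
     + d * (path_sum b i c * path_sum b (Suc r) j)"
proof -
  let ?b' = "\<lambda>r' c'. if r' = r \<and> c' = c then b r c - d else b r' c'"
  have "(\<Sum>r'\<in>{c..<j}. path_sum b i c' * (b r' c' - ?b' r' c') * path_sum b (Suc r') j)
      = (if c' = c then d * (path_sum b i c * path_sum b (Suc r) j) else 0)" for c'
  proof -
    have "(\<Sum>r'\<in>{c..<j}. path_sum b i c' * (b r' c' - ?b' r' c') * path_sum b (Suc r') j)
      = (\<Sum>r'\<in>{c..<j}. if r' = r then
           if c' = c then d * (path_sum b i c * path_sum b (Suc r) j) else 0 else 0)"
      by (intro sum.cong refl) simp
    then show ?thesis using assms by simp
  qed
  then have "(\<Sum>c'\<in>{i..c}. \<Sum>r'\<in>{c..<j}.
      path_sum b i c' * (b r' c' - ?b' r' c') * path_sum b (Suc r') j)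
    = d * (path_sum b i c * path_sum b (Suc r) j)"
    using assms by simp
  moreover have "path_sum b i j = path_sum ?b' i j + (\<Sum>c'\<in>{i..c}. \<Sum>r'\<in>{c..<j}.
      path_sum b i c' * (b r' c' - ?b' r' c') * path_sum b (Suc r') j)"
    by (rule path_sum_perturb) (use assms in auto)
  ultimately show ?thesis by simp
qed

text \<open>
  With superdiagonal \<open>-1\<close>, the vector \<open>(path_sum b i i, ..., path_sum b i (i +
  m - 1))\<close> is annihilated by every row except the last, by the recursion for path sums.
  Replacing the first column of the identity by this vector gives a unitriangular
  \<open>V\<close>, and the first column of \<open>B * V\<close> vanishes except in the last row;
  deleting that row and column leaves a triangular matrix with diagonal \<open>-1\<close>.
\<close>

lemma det_hessenberg:
  "det (mat m m (\<lambda>(r, c). if c \<le> r then b (i + r) (i + c) else if c = Suc r then -1 else 0))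
     = path_sum b i (i + m)"
proof (cases m)
  case 0
  then show ?thesis by simp
next
  case (Suc k)
  define B where "B = mat m m (\<lambda>(r, c). if c \<le> r then b (i + r) (i + c) else if c = Suc r then -1 else 0)"
  define V where "V = mat m m (\<lambda>(r, c). if c = 0 then path_sum b i (i + r) else if r = c then 1 else 0)"
  define W where "W = mat m m (\<lambda>(r, c). if c = 0 then (if r = k then path_sum b i (i + m) else 0) else B $$ (r, c))"
  have carr: "B \<in> carrier_mat m m" "V \<in> carrier_mat m m" "W \<in> carrier_mat m m"
    by (auto simp: B_def V_def W_def)
  have detV: "det V = 1"
    by (subst det_lower_triangular[OF _ carr(2)]) (auto simp: V_def diag_mat_def intro!: prod_list_neutral)
  have BV: "B * V = W"
  proof (rule eq_matI)
    fix r c assume "r < dim_row W" "c < dim_col W"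
    then have rc: "r < m" "c < m" by (auto simp: W_def)
    have e: "(B * V) $$ (r, c) = (\<Sum>t\<in>{0..<m}. B $$ (r, t) * V $$ (t, c))"
      using carr rc by (simp add: scalar_prod_def)
    show "(B * V) $$ (r, c) = W $$ (r, c)"
    proof (cases "c = 0")
      case False
      have "(\<Sum>t\<in>{0..<m}. B $$ (r, t) * V $$ (t, c)) = (\<Sum>t\<in>{0..<m}. if t = c then B $$ (r, t) else 0)"
        using rc False by (intro sum.cong refl) (auto simp: V_def)
      then show ?thesis using rc False unfolding e by (simp add: W_def)
    next
      case True
      have s1: "(\<Sum>t\<in>{0..r}. b (i + r) (i + t) * path_sum b i (i + t)) = path_sum b i (Suc (i + r))"
        using sum.shift_bounds_cl_nat_ivl[of "\<lambda>c. path_sum b i c * b (i + r) c" 0 i r]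
        by (simp add: path_sum_Suc ac_simps)
      have "(\<Sum>t\<in>{0..<m}. B $$ (r, t) * V $$ (t, c)) =
         (\<Sum>t\<in>{0..<m}. (if t \<le> r then b (i + r) (i + t) * path_sum b i (i + t) else 0)
            + (if t = Suc r then - path_sum b i (i + t) else 0))"
        using rc True by (intro sum.cong refl) (auto simp: B_def V_def)
      also have "\<dots> = path_sum b i (Suc (i + r)) + (if Suc r < m then - path_sum b i (i + Suc r) else 0)"
      proof -
        have "(\<Sum>t\<in>{0..<m}. if t \<le> r then b (i + r) (i + t) * path_sum b i (i + t) else 0)
          = (\<Sum>t\<in>{0..r}. b (i + r) (i + t) * path_sum b i (i + t))"
          by (rule sum.mono_neutral_cong_right) (use rc in auto)
        then show ?thesis by (simp add: sum.distrib s1)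
      qed
      also have "\<dots> = W $$ (r, c)"
        using rc True Suc by (auto simp: W_def)
      finally show ?thesis using e by simp
    qed
  qed (use carr in \<open>auto simp: W_def\<close>)
  have "det B = det B * det V" using detV by simp
  also have "\<dots> = det W" using det_mult[OF carr(1,2)] BV by simp
  also have "\<dots> = (\<Sum>r<m. W $$ (r, 0) * cofactor W r 0)"
    by (rule laplace_expansion_column[OF carr(3)]) (simp add: Suc)
  also have "\<dots> = (\<Sum>r<m. if r = k then path_sum b i (i + m) * cofactor W k 0 else 0)"
    by (intro sum.cong refl) (auto simp: W_def Suc)
  also have "\<dots> = path_sum b i (i + m) * cofactor W k 0" by (simp add: Suc)
  also have "cofactor W k 0 = 1"
  proof -
    have D: "mat_delete W k 0 \<in> carrier_mat k k"
      using carr Suc by (auto simp: mat_delete_def)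
    have "det (mat_delete W k 0) = prod_list (diag_mat (mat_delete W k 0))"
      by (rule det_lower_triangular[OF _ D]) (auto simp: mat_delete_def W_def B_def Suc)
    also have "diag_mat (mat_delete W k 0) = replicate k (-1)"
      by (rule nth_equalityI) (auto simp: diag_mat_def mat_delete_def W_def B_def Suc)
    \<comment> \<open>the sign of the cofactor cancels the product of the diagonal entries\<close>
    finally show ?thesis by (simp add: cofactor_def power_add[symmetric] flip: power_mult_distrib)
  qed
  finally show ?thesis by (simp add: B_def)
qed

section \<open>Nilpotency and the characteristic polynomial\<close>

text \<open>
  The indeterminate is a prime element over a domain, so a power of it factors only into powers of
  it. Concretely, the constant term of one factor vanishes and the indeterminate can be cancelled
  there.
\<close>

lemma monic_mult_eq_monom:
  fixes p q :: "'r::idom poly"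
  assumes "p * q = monom 1 m" "lead_coeff p = 1" "lead_coeff q = 1"
  shows "p = monom 1 (degree p)"
  using assms
proof (induction m arbitrary: p q)
  case 0
  then have "degree p + degree q = 0"
    by (metis degree_monom_eq degree_mult_eq leading_coeff_0_iff one_neq_zero)
  then show ?case using 0 by (metis add_is_0 degree_0_id lead_coeff_monom monom_0)
next
  case (Suc m)
  have "coeff p 0 * coeff q 0 = 0"
    using arg_cong[OF Suc.prems(1), of "\<lambda>p. coeff p 0"] by (simp add: coeff_mult)
  then consider "coeff p 0 = 0" | "coeff q 0 = 0" by auto
  then show ?case
  proof cases
    case 1
    then obtain p' where p': "p = pCons 0 p'" by (cases p) auto
    have nz: "p' \<noteq> 0" using p' Suc.prems by auto
    have "p' * q = monom 1 m" using Suc.prems(1) by (simp add: p' monom_Suc)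
    moreover have "lead_coeff p' = 1" using Suc.prems(2) nz by (simp add: p')
    ultimately have "p' = monom 1 (degree p')" using Suc.IH Suc.prems(3) by blast
    then have "p = monom 1 (Suc (degree p'))" by (simp add: p' monom_Suc)
    then show ?thesis by (simp add: degree_monom_eq)
  next
    case 2
    then obtain q' where q': "q = pCons 0 q'" by (cases q) auto
    have "p * q' = monom 1 m" using Suc.prems(1) by (simp add: q' monom_Suc)
    moreover have "lead_coeff q' = 1" using Suc.prems(3) by (auto simp: q' split: if_splits)
    ultimately show ?thesis using Suc.IH Suc.prems(2) by blast
  qed
qed

lemma char_poly_matrix_index:
  assumes "A \<in> carrier_mat n n" "r < n" "c < n"
  shows "char_poly_matrix A $$ (r, c) = (if r = c then [:0, 1:] else 0) - [:A $$ (r, c):]"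
  using assms by (auto simp: char_poly_matrix_def)

lemma times_mat_index:
  assumes "A \<in> carrier_mat n n" "B \<in> carrier_mat n n" "r < n" "c < n"
  shows "(A * B) $$ (r, c) = (\<Sum>t\<in>{0..<n}. A $$ (r, t) * B $$ (t, c))"
  using assms by (simp add: scalar_prod_def)

text \<open>
  Let \<open>X\<close> be the indeterminate. The matrix \<open>X - A\<close> divides \<open>X ^ m
  - A ^ m\<close>, which is \<open>X ^ m\<close> if \<open>A ^ m = 0\<close>. Taking determinants,
  the characteristic polynomial of \<open>A\<close> divides a power of \<open>X\<close>. No
  eigenvalues are involved, hence the argument works over any integral domain, in particular over
  the ring of multivariate polynomials.
\<close>

lemma char_poly_of_nilpotent:
  fixes A :: "'r::idom mat"
  assumes A: "A \<in> carrier_mat n n" and "nilpotent_mat A"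
  shows "char_poly A = monom 1 n"
proof -
  from assms obtain m where m: "A ^\<^sub>m m = 0\<^sub>m n n" by (auto simp: nilpotent_mat_def)
  define C where "C = char_poly_matrix A"
  define K where "K j = map_mat (\<lambda>a. [:a:]) (A ^\<^sub>m j)" for j
  have C: "C \<in> carrier_mat n n" using A by (simp add: C_def)
  have K: "K j \<in> carrier_mat n n" for j using A by (simp add: K_def)
  have KC: "K j * C = monom 1 1 \<cdot>\<^sub>m K j - K (Suc j)" for j
  proof (rule eq_matI)
    fix r c assume "r < dim_row (monom 1 1 \<cdot>\<^sub>m K j - K (Suc j))" "c < dim_col (monom 1 1 \<cdot>\<^sub>m K j - K (Suc j))"
    then have rc: "r < n" "c < n" using K[of "Suc j"] by auto
    define P where "P = A ^\<^sub>m j"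
    have P: "P \<in> carrier_mat n n" using A by (simp add: P_def)
    have "(K j * C) $$ (r, c) = (\<Sum>t\<in>{0..<n}. [:P $$ (r, t):] * ((if t = c then [:0, 1:] else 0) - [:A $$ (t, c):]))"
      unfolding times_mat_index[OF K C rc] using P rc A
      by (intro sum.cong refl) (simp add: C_def char_poly_matrix_index K_def flip: P_def)
    also have "\<dots> = (\<Sum>t\<in>{0..<n}. (if t = c then [:0, P $$ (r, c):] else 0) - [:P $$ (r, t) * A $$ (t, c):])"
      by (intro sum.cong refl) (auto simp: algebra_simps)
    also have "\<dots> = [:0, P $$ (r, c):] - [:\<Sum>t\<in>{0..<n}. P $$ (r, t) * A $$ (t, c):]"
    proof -
      have "(\<Sum>t\<in>I. [:f t:]) = [:sum f I:]" for f :: "nat \<Rightarrow> 'r" and I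
        by (induction I rule: infinite_finite_induct) auto
      then show ?thesis using rc by (simp add: sum_subtractf)
    qed
    also have "\<dots> = (monom 1 1 \<cdot>\<^sub>m K j - K (Suc j)) $$ (r, c)"
      using rc A P by (simp add: K_def scalar_prod_def monom_Suc monom_0 flip: P_def)
    finally show "(K j * C) $$ (r, c) = (monom 1 1 \<cdot>\<^sub>m K j - K (Suc j)) $$ (r, c)" .
  qed (use C K[of j] K[of "Suc j"] in auto)
  have "\<exists>S\<in>carrier_mat n n. S * C = monom 1 j \<cdot>\<^sub>m 1\<^sub>m n - K j" for j
  proof (induction j)
    case 0
    have "K 0 = 1\<^sub>m n" using A by (intro eq_matI) (auto simp: K_def one_pCons)
    moreover have "monom 1 0 \<cdot>\<^sub>m 1\<^sub>m n - 1\<^sub>m n = (0\<^sub>m n n :: 'r poly mat)"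
      by (intro eq_matI) (auto simp: monom_0 one_pCons)
    ultimately show ?case using C by (intro bexI[of _ "0\<^sub>m n n"]) auto
  next
    case (Suc j)
    then obtain S where S: "S \<in> carrier_mat n n" "S * C = monom 1 j \<cdot>\<^sub>m 1\<^sub>m n - K j" by blast
    have "(monom 1 1 \<cdot>\<^sub>m S + K j) * C = monom 1 1 \<cdot>\<^sub>m (S * C) + K j * C"
      using C S(1) K[of j] by (simp add: add_mult_distrib_mat[of _ n n] mult_smult_assoc_mat[of _ n n _ n])
    also have "\<dots> = monom 1 (Suc j) \<cdot>\<^sub>m 1\<^sub>m n - K (Suc j)"
      unfolding S(2) KC using K[of j] K[of "Suc j"]
      by (intro eq_matI) (auto simp: algebra_simps mult_monom)
    finally show ?case using S K[of j] by (intro bexI[of _ "monom 1 1 \<cdot>\<^sub>m S + K j"]) auto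
  qed
  then obtain S where S: "S \<in> carrier_mat n n" "S * C = monom 1 m \<cdot>\<^sub>m 1\<^sub>m n - K m" by blast
  have "K m = 0\<^sub>m n n" by (intro eq_matI) (auto simp: K_def m)
  then have "S * C = monom 1 m \<cdot>\<^sub>m 1\<^sub>m n" using S(2) by auto
  then have "det C * det S = monom 1 m ^ n"
    using det_mult[OF S(1) C] by (simp add: mult.commute)
  then have prod: "char_poly A * det S = monom 1 (m * n)"
    by (simp add: C_def char_poly_def monom_power)
  have monic: "degree (char_poly A) = n" "coeff (char_poly A) n = 1"
    using degree_monic_char_poly[OF A] by auto
  have "lead_coeff (char_poly A) * lead_coeff (det S) = 1"
    using arg_cong[OF prod, of lead_coeff] by (simp add: lead_coeff_mult degree_monom_eq)
  then show ?thesis using monic_mult_eq_monom[OF prod] monic by simp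
qed

text \<open>
  A special case of the Cayley--Hamilton theorem, by its classical proof: the adjugate of \<open>X
  - A\<close> is a polynomial in \<open>X\<close> with matrix coefficients \<open>M i\<close>, and
  comparing coefficients in \<open>adj (X - A) * (X - A) = X ^ n\<close> gives \<open>M (n - 1 -
  j) = A ^ j\<close> and \<open>M 0 * A = 0\<close>.
\<close>

lemma nilpotent_of_char_poly:
  fixes A :: "'r::comm_ring_1 mat"
  assumes A: "A \<in> carrier_mat n n" and cp: "char_poly A = monom 1 n"
  shows "nilpotent_mat A"
proof (cases "n = 0")
  case True
  then show ?thesis using A by (auto simp: nilpotent_mat_def intro!: exI[of _ 0])
next
  case False
  define C where "C = char_poly_matrix A"
  define B where "B = adj_mat C"
  have C: "C \<in> carrier_mat n n" using A by (simp add: C_def)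
  have B: "B \<in> carrier_mat n n" "B * C = monom 1 n \<cdot>\<^sub>m 1\<^sub>m n"
    using adj_mat[OF C] cp by (auto simp: B_def C_def char_poly_def)
  define M where "M i = map_mat (\<lambda>p. coeff p i) B" for i
  have M: "M i \<in> carrier_mat n n" for i using B by (simp add: M_def)
  have entry: "[:0, 1:] * B $$ (r, c) - (\<Sum>t\<in>{0..<n}. Polynomial.smult (A $$ (t, c)) (B $$ (r, t))) = (if r = c then monom 1 n else 0)"
    if rc: "r < n" "c < n" for r c
  proof -
    have "(B * C) $$ (r, c) = (\<Sum>t\<in>{0..<n}. B $$ (r, t) * ((if t = c then [:0, 1:] else 0) - [:A $$ (t, c):]))"
      unfolding times_mat_index[OF B(1) C rc] using rc A
      by (intro sum.cong refl) (simp add: C_def char_poly_matrix_index)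
    also have "\<dots> = (\<Sum>t\<in>{0..<n}. (if t = c then [:0, 1:] * B $$ (r, c) else 0) - Polynomial.smult (A $$ (t, c)) (B $$ (r, t)))"
      by (intro sum.cong refl) (auto simp: algebra_simps)
    also have "\<dots> = [:0, 1:] * B $$ (r, c) - (\<Sum>t\<in>{0..<n}. Polynomial.smult (A $$ (t, c)) (B $$ (r, t)))"
      using rc by (simp add: sum_subtractf)
    finally show ?thesis using B rc by (cases "r = c") simp_all
  qed
  have MA: "(M i * A) $$ (r, c) = (\<Sum>t\<in>{0..<n}. A $$ (t, c) * coeff (B $$ (r, t)) i)" if "r < n" "c < n" for i r c
    using that M[of i] A B by (simp add: scalar_prod_def M_def mult.commute)
  have step: "M i = M (Suc i) * A + (if Suc i = n then 1\<^sub>m n else 0\<^sub>m n n)" for i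
  proof (rule eq_matI)
    fix r c assume "r < dim_row (M (Suc i) * A + (if Suc i = n then 1\<^sub>m n else 0\<^sub>m n n))"
      "c < dim_col (M (Suc i) * A + (if Suc i = n then 1\<^sub>m n else 0\<^sub>m n n))"
    then have rc: "r < n" "c < n" by (auto split: if_splits)
    have "coeff (B $$ (r, c)) i - (\<Sum>t\<in>{0..<n}. A $$ (t, c) * coeff (B $$ (r, t)) (Suc i)) = (if r = c \<and> Suc i = n then 1 else 0)"
      using arg_cong[OF entry[OF rc], of "\<lambda>p. coeff p (Suc i)"] by (simp add: coeff_sum split: if_splits)
    then show "M i $$ (r, c) = (M (Suc i) * A + (if Suc i = n then 1\<^sub>m n else 0\<^sub>m n n)) $$ (r, c)"
      using rc MA[OF rc, of "Suc i"] M[of "Suc i"] A B by (auto simp: M_def algebra_simps)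
  qed (use M[of i] M[of "Suc i"] A in auto)
  have start: "M 0 * A = 0\<^sub>m n n"
  proof (rule eq_matI)
    fix r c assume "r < dim_row (0\<^sub>m n n)" "c < dim_col (0\<^sub>m n n)"
    then have rc: "r < n" "c < n" by auto
    show "(M 0 * A) $$ (r, c) = 0\<^sub>m n n $$ (r, c)"
      using arg_cong[OF entry[OF rc], of "\<lambda>p. coeff p 0"] MA[OF rc, of 0] rc False
      by (simp add: coeff_sum split: if_splits)
  qed (use M[of 0] A in auto)
  \<comment> \<open>beyond \<open>N\<close> all coefficients of the adjugate vanish; this starts the downward induction\<close>
  define N where "N = Suc (Max ((\<lambda>(r, c). degree (B $$ (r, c))) ` ({0..<n} \<times> {0..<n})))"
  have high: "M i = 0\<^sub>m n n" if "N \<le> i" for i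
  proof (rule eq_matI)
    fix r c assume "r < dim_row (0\<^sub>m n n)" "c < dim_col (0\<^sub>m n n)"
    then have rc: "r < n" "c < n" by auto
    then have "degree (B $$ (r, c)) \<le> Max ((\<lambda>(r, c). degree (B $$ (r, c))) ` ({0..<n} \<times> {0..<n}))"
      by (intro Max_ge) force+
    then have "degree (B $$ (r, c)) < i" using that by (simp add: N_def)
    then show "M i $$ (r, c) = 0\<^sub>m n n $$ (r, c)" using rc B by (simp add: M_def coeff_eq_0)
  qed (use M[of i] in auto)
  have top: "M i = 0\<^sub>m n n" if "n \<le> i" for i
    using that
  proof (induction "N - i" arbitrary: i)
    case 0
    then show ?case by (simp add: high)
  next
    case (Suc d)
    then have "M (Suc i) = 0\<^sub>m n n" by simp
    then show ?case using Suc.prems A step[of i] by simp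
  qed
  have low: "j < n \<Longrightarrow> M (n - Suc j) = A ^\<^sub>m j" for j
  proof (induction j)
    case 0
    then show ?case using step[of "n - 1"] top[of n] A by simp
  next
    case (Suc j)
    then have "M (n - Suc (Suc j)) = M (n - Suc j) * A + 0\<^sub>m n n"
      using step[of "n - Suc (Suc j)"] by (auto simp: Suc_diff_Suc)
    also have "\<dots> = A ^\<^sub>m j * A"
      using Suc A by (simp add: right_add_zero_mat[of _ n n] mult_carrier_mat[of _ n n])
    finally show ?case by simp
  qed
  have "A ^\<^sub>m n = A ^\<^sub>m (n - 1) * A" using False by (cases n) auto
  also have "\<dots> = 0\<^sub>m n n" using low[of "n - 1"] start False by simp
  finally show ?thesis using A by (auto simp: nilpotent_mat_def)
qed

lemma nilpotent_iff_char_poly: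
  fixes A :: "'r::idom mat"
  assumes "A \<in> carrier_mat n n"
  shows "nilpotent_mat A \<longleftrightarrow> char_poly A = monom 1 n"
  using char_poly_of_nilpotent nilpotent_of_char_poly assms by blast

section \<open>Coefficients of a single variable\<close>

lemma mconst_0 [simp]: "mconst 0 = 0" and mconst_1 [simp]: "mconst 1 = 1"
  by (simp_all add: mconst_def)

lemma lookup_mconst: "Poly_Mapping.lookup (mconst c) m = (if m = 0 then c else 0)"
  by (simp add: mconst_def lookup_single when_def)

lemma lookup_mvar:
  "Poly_Mapping.lookup (mvar k :: 'a::zero_neq_one mpoly) m = (if m = Poly_Mapping.single k 1 then 1 else 0)"
  by (simp add: mvar_def lookup_single when_def)

lemma single_1_neq_0: "Poly_Mapping.single (k::nat) (1::nat) \<noteq> 0"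
  by (metis lookup_single_eq lookup_zero one_neq_zero)

lemma lookup_0_mvar [simp]: "Poly_Mapping.lookup (mvar k :: 'a::zero_neq_one mpoly) 0 = 0"
  using single_1_neq_0[of k] by (auto simp: lookup_mvar)

lemma mvar_neq_mconst: "(mvar k :: 'a::zero_neq_one mpoly) \<noteq> mconst c"
proof
  assume "(mvar k :: 'a mpoly) = mconst c"
  then have "Poly_Mapping.lookup (mvar k :: 'a mpoly) (Poly_Mapping.single k 1) 
    = Poly_Mapping.lookup (mconst c) (Poly_Mapping.single k 1)" by simp
  then show False using single_1_neq_0[of k] by (simp add: lookup_mvar lookup_mconst)
qed

lemma mvar_neq_0: "(mvar k :: 'a::zero_neq_one mpoly) \<noteq> 0"
  using mvar_neq_mconst[of k "0::'a"] by simp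

lemma mvar_neq_1: "(mvar k :: 'a::{comm_semiring_1} mpoly) \<noteq> 1"
  using mvar_neq_mconst[of k "1::'a"] by simp

text \<open>
  Setting all variables to 0 extracts the constant term, which is easier to recognise as a ring
  homomorphism than the evaluation itself.
\<close>

lemma meval_zero: "meval (\<lambda>_. 0) p = Poly_Mapping.lookup p 0"
  for p :: "'a::comm_semiring_1 mpoly"
proof -
  have "Poly_Mapping.lookup p m * (\<Prod>v\<in>Poly_Mapping.keys m. 0 ^ Poly_Mapping.lookup m v)
      = (if m = 0 then Poly_Mapping.lookup p 0 else 0)" for m :: "nat \<Rightarrow>\<^sub>0 nat"
  proof (cases "m = 0")
    case False
    then obtain v where v: "v \<in> Poly_Mapping.keys m" using keys_eq_empty[of m] by blast
    then have "(\<Prod>v\<in>Poly_Mapping.keys m. (0::'a) ^ Poly_Mapping.lookup m v) = 0"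
      by (intro prod_zero bexI[OF _ v]) (simp_all add: v[unfolded in_keys_iff] power_0_left)
    then show ?thesis using False by simp
  qed simp
  then show ?thesis
    by (simp add: meval_def in_keys_iff)
qed

lemma comm_ring_hom_mconst: "comm_ring_hom (mconst :: 'a::comm_ring_1 \<Rightarrow> 'a mpoly)"
  by unfold_locales (simp_all add: mconst_def single_add mult_single)

lemma comm_ring_hom_constant_term: "comm_ring_hom (\<lambda>p :: 'a::comm_ring_1 mpoly. Poly_Mapping.lookup p 0)"
proof unfold_locales
  fix p q :: "'a mpoly"
  have "Poly_Mapping.lookup p l * (\<Sum>m. Poly_Mapping.lookup q m when 0 = l + m) =
     (Poly_Mapping.lookup p 0 * Poly_Mapping.lookup q 0 when l = 0)" for l :: "nat \<Rightarrow>\<^sub>0 nat"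
  proof (cases "l = 0")
    case False
    have "0 \<noteq> l + m" for m
    proof
      assume "0 = l + m"
      then have "Poly_Mapping.lookup l x = 0" for x
        by (metis add_is_0 lookup_add lookup_zero)
      then show False using False by (metis poly_mapping_eqI lookup_zero)
    qed
    then show ?thesis using False by simp
  qed simp
  then show "Poly_Mapping.lookup (p * q) 0 = Poly_Mapping.lookup p 0 * Poly_Mapping.lookup q 0"
    by (simp add: lookup_mult)
qed (simp_all add: lookup_add lookup_one)

text \<open>
  A subring whose elements cannot contribute to the coefficient of the variable with index
  \<open>k\<close>.
\<close>

definition var_free :: "nat \<Rightarrow> 'a::zero mpoly set" where
  "var_free k = {p. \<forall>m\<in>Poly_Mapping.keys p. Poly_Mapping.lookup m k = 0}"

lemma var_free_mconst [simp]: "mconst c \<in> var_free k"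
  by (auto simp: var_free_def in_keys_iff lookup_mconst split: if_splits)

lemma var_free_mvar: "j \<noteq> k \<Longrightarrow> (mvar j :: 'a::zero_neq_one mpoly) \<in> var_free k"
  by (auto simp: var_free_def in_keys_iff lookup_mvar lookup_single when_def split: if_splits)

lemma var_free_0 [simp]: "0 \<in> var_free k"
  by (auto simp: var_free_def)

lemma var_free_1 [simp]: "(1 :: 'a::comm_ring_1 mpoly) \<in> var_free k"
  using var_free_mconst[of "1::'a" k] by simp

lemma var_free_add: "p \<in> var_free k \<Longrightarrow> q \<in> var_free k \<Longrightarrow> p + q \<in> var_free k"
  for p q :: "'a::comm_monoid_add mpoly"
  using keys_add[of p q] by (auto simp: var_free_def)

lemma var_free_diff: "p \<in> var_free k \<Longrightarrow> q \<in> var_free k \<Longrightarrow> p - q \<in> var_free k"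
  for p q :: "'a::ab_group_add mpoly"
  using keys_diff[of p q] by (auto simp: var_free_def)

lemma var_free_mult: "p \<in> var_free k \<Longrightarrow> q \<in> var_free k \<Longrightarrow> p * q \<in> var_free k"
  for p q :: "'a::comm_ring_1 mpoly"
  using keys_mult[of p q] by (fastforce simp: var_free_def lookup_add)

lemma var_free_sum: "(\<And>i. i \<in> I \<Longrightarrow> f i \<in> var_free k) \<Longrightarrow> sum f I \<in> var_free k"
  for f :: "'i \<Rightarrow> 'a::comm_monoid_add mpoly"
  by (induction I rule: infinite_finite_induct) (auto intro: var_free_add)

lemma var_free_mvar_mult:
  fixes p :: "'a::comm_ring_1 mpoly"
  assumes "mvar k * p \<in> var_free k"
  shows "p = 0"
proof (rule ccontr)
  assume "p \<noteq> 0"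
  then obtain m where m: "Poly_Mapping.lookup p m \<noteq> 0" by (metis poly_mapping_eqI lookup_zero)
  let ?e = "Poly_Mapping.single k (1::nat)"
  have "Poly_Mapping.lookup (mvar k * p) (?e + m) = (\<Sum>l. Poly_Mapping.lookup (mvar k :: 'a mpoly) l * (\<Sum>q. Poly_Mapping.lookup p q when ?e + m = l + q))"
    by (rule lookup_mult)
  also have "\<dots> = (\<Sum>l. Poly_Mapping.lookup p m when l = ?e)"
  proof (intro arg_cong[of _ _ Sum_any] ext)
    fix l
    show "Poly_Mapping.lookup (mvar k :: 'a mpoly) l * (\<Sum>q. Poly_Mapping.lookup p q when ?e + m = l + q)
        = (Poly_Mapping.lookup p m when l = ?e)"
      by (cases "l = ?e") (simp_all add: lookup_mvar)
  qed
  also have "\<dots> = Poly_Mapping.lookup p m" by simp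
  finally have "?e + m \<in> Poly_Mapping.keys (mvar k * p)" using m by (simp add: in_keys_iff)
  then show False using assms by (auto simp: var_free_def lookup_add)
qed

definition coeffs_var_free :: "nat \<Rightarrow> 'a::zero mpoly poly set" where
  "coeffs_var_free k = {p. \<forall>i. coeff p i \<in> var_free k}"

lemma coeffs_var_free_0 [simp]: "0 \<in> coeffs_var_free k"
  by (simp add: coeffs_var_free_def)

lemma coeffs_var_free_monom: "a \<in> var_free k \<Longrightarrow> monom a i \<in> coeffs_var_free k"
  by (simp add: coeffs_var_free_def)

lemma coeffs_var_free_pCons:
  "a \<in> var_free k \<Longrightarrow> p \<in> coeffs_var_free k \<Longrightarrow> pCons a p \<in> coeffs_var_free k"
  by (auto simp: coeffs_var_free_def coeff_pCons split: nat.split)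

lemma coeffs_var_free_1 [simp]: "(1 :: 'a::comm_ring_1 mpoly poly) \<in> coeffs_var_free k"
  by (simp add: one_pCons coeffs_var_free_pCons)

lemma coeffs_var_free_add: "p \<in> coeffs_var_free k \<Longrightarrow> q \<in> coeffs_var_free k \<Longrightarrow> p + q \<in> coeffs_var_free k"
  for p q :: "'a::comm_monoid_add mpoly poly"
  by (simp add: coeffs_var_free_def var_free_add)

lemma coeffs_var_free_diff: "p \<in> coeffs_var_free k \<Longrightarrow> q \<in> coeffs_var_free k \<Longrightarrow> p - q \<in> coeffs_var_free k"
  for p q :: "'a::ab_group_add mpoly poly"
  by (simp add: coeffs_var_free_def var_free_diff)

lemma coeffs_var_free_mult: "p \<in> coeffs_var_free k \<Longrightarrow> q \<in> coeffs_var_free k \<Longrightarrow> p * q \<in> coeffs_var_free k"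
  for p q :: "'a::comm_ring_1 mpoly poly"
  by (simp add: coeffs_var_free_def coeff_mult var_free_sum var_free_mult)

lemma coeffs_var_free_sum: "(\<And>i. i \<in> I \<Longrightarrow> f i \<in> coeffs_var_free k) \<Longrightarrow> sum f I \<in> coeffs_var_free k"
  for f :: "'i \<Rightarrow> 'a::comm_monoid_add mpoly poly"
  by (simp add: coeffs_var_free_def coeff_sum var_free_sum)

text \<open>
  An element that is affine in one variable determines the coefficient of that variable: the
  difference of the two variable-free parts is free of the variable, whereas a nonzero multiple of
  the variable never is.
\<close>

lemma mvar_coefficient_unique:
  fixes u v u' v' :: "'a::comm_ring_1 mpoly poly"
  assumes "u - Polynomial.smult (mvar k) v = u' - Polynomial.smult (mvar k) v'"
    and "u \<in> coeffs_var_free k" "u' \<in> coeffs_var_free k"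
  shows "v = v'"
proof (rule poly_eqI)
  fix i
  have "coeff u i - mvar k * coeff v i = coeff u' i - mvar k * coeff v' i"
    using arg_cong[OF assms(1), of "\<lambda>p. coeff p i"] by simp
  then have "mvar k * (coeff v i - coeff v' i) = coeff u i - coeff u' i"
    by (simp add: algebra_simps)
  moreover have "coeff u i - coeff u' i \<in> var_free k"
    using assms(2,3) by (simp add: coeffs_var_free_def var_free_diff)
  ultimately show "coeff v i = coeff v' i"
    using var_free_mvar_mult[of k "coeff v i - coeff v' i"] by simp
qed

section \<open>Blocks of unit lower Hessenberg matrices\<close>

text \<open>
  Rows and columns \<open>i, ..., j - 1\<close>, counted from 0. In contrast to the enumeration of
  index sets that underlies \<open>submatrix\<close>, the entries are given by an explicit shift.
\<close>

definition block :: "'a mat \<Rightarrow> nat \<Rightarrow> nat \<Rightarrow> 'a mat" where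
  "block A i j = mat (j - i) (j - i) (\<lambda>(r, c). A $$ (i + r, i + c))"

lemma pick_interval:
  assumes "\<And>a. i \<le> a \<Longrightarrow> a \<le> i + t \<Longrightarrow> a \<in> I" "\<And>a. a < i \<Longrightarrow> a \<notin> I"
  shows "pick I t = i + t"
proof -
  have "{a \<in> I. a < i + t} = {i..<i + t}"
    using assms by (auto simp: not_less[symmetric])
  then have "pick I t = pick I (card {a \<in> I. a < i + t})" by simp
  also have "\<dots> = i + t"
    by (rule pick_card_in_set) (use assms in auto)
  finally show ?thesis .
qed

lemma principal_submatrix_eq_block:
  assumes "A \<in> carrier_mat n n" "j \<le> n"
  shows "principal_submatrix A (Suc i) j = block A i j"
proof -
  define I where "I = {r. Suc i \<le> r + 1 \<and> r + 1 \<le> j}"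
  have I: "a \<in> I \<longleftrightarrow> i \<le> a \<and> a < j" for a by (auto simp: I_def)
  have "{r. r < n \<and> r \<in> I} = {i..<j}" using assms by (auto simp: I)
  then have card: "card {r. r < dim_row A \<and> r \<in> I} = j - i" "card {r. r < dim_col A \<and> r \<in> I} = j - i"
    using assms(1) by auto
  have pick: "pick I t = i + t" if "t < j - i" for t
    by (rule pick_interval) (use that in \<open>auto simp: I\<close>)
  show ?thesis
    unfolding principal_submatrix_def I_def[symmetric] submatrix_def card block_def
    by (rule cong_mat) (simp_all add: pick)
qed

lemma elements_corner_block:
  assumes A: "A \<in> carrier_mat n n" and rc: "c \<le> s" "s \<le> r" "r < n"
  shows "A $$ (r, c) \<in> elements_mat (corner_block A (Suc s))"
proof -
  define I where "I = {r. Suc s \<le> r + 1}"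
  define J where "J = {c. c + 1 \<le> Suc s}"
  have IJ: "r \<in> I" "c \<in> J" "r < dim_row A" "c < dim_col A" using assms by (auto simp: I_def J_def)
  have "{a \<in> I. a < r} \<subset> {a. a < dim_row A \<and> a \<in> I}" using IJ by auto
  then have 1: "card {a \<in> I. a < r} < card {a. a < dim_row A \<and> a \<in> I}"
    by (simp add: psubset_card_mono)
  have "{a \<in> J. a < c} \<subset> {a. a < dim_col A \<and> a \<in> J}" using IJ by auto
  then have 2: "card {a \<in> J. a < c} < card {a. a < dim_col A \<and> a \<in> J}"
    by (simp add: psubset_card_mono)
  have "submatrix A I J $$ (card {a \<in> I. a < r}, card {a \<in> J. a < c}) = A $$ (r, c)"
    by (rule submatrix_index_card) (fact IJ)+
  then show ?thesis
    unfolding corner_block_def I_def[symmetric] J_def[symmetric]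
    using elements_matI[OF _ 1 2, of "submatrix A I J" "A $$ (r, c)"]
    by (metis carrier_matI dim_submatrix)
qed

text \<open>
  The entries of the matrix \<open>X - A\<close>, as a function, so that one family of weights
  serves all principal blocks of \<open>A\<close> at once.
\<close>

definition char_entry :: "'a::comm_ring_1 mat \<Rightarrow> nat \<Rightarrow> nat \<Rightarrow> 'a poly" where
  "char_entry A r c = (if r = c then [:0, 1:] else 0) - [:A $$ (r, c):]"

lemma char_poly_block:
  assumes "A \<in> carrier_mat n n" "ULH A" "i \<le> j" "j \<le> n"
  shows "char_poly (block A i j) = path_sum (char_entry A) i j"
proof -
  let ?B = "block A i j"
  let ?H = "mat (j - i) (j - i) (\<lambda>(r, c). if c \<le> r then char_entry A (i + r) (i + c)
     else if c = Suc r then -1 else 0)"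
  have B: "?B \<in> carrier_mat (j - i) (j - i)" by (simp add: block_def)
  have "char_poly_matrix ?B = ?H"
  proof (rule eq_matI)
    fix r c
    assume "r < dim_row ?H" "c < dim_col ?H"
    then have rc: "r < j - i" "c < j - i" by auto
    then have "i + r < n" "i + c < n" using assms by auto
    then have "c = Suc r \<longrightarrow> A $$ (i + r, i + c) = 1" "Suc r < c \<longrightarrow> A $$ (i + r, i + c) = 0"
      using assms(1,2) unfolding ULH_def by auto
    then show "char_poly_matrix ?B $$ (r, c) = ?H $$ (r, c)"
      unfolding char_poly_matrix_index[OF B rc] using rc
      by (auto simp: char_entry_def block_def one_pCons)
  qed (use char_poly_matrix_closed[OF B] in auto)
  then show ?thesis
    using det_hessenberg[of "j - i" "char_entry A" i] assms(3) by (simp add: char_poly_def)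
qed

lemma char_poly_eq_path_sum:
  assumes "A \<in> carrier_mat n n" "ULH A"
  shows "char_poly A = path_sum (char_entry A) 0 n"
proof -
  have "block A 0 n = A" using assms by (auto simp: block_def)
  then show ?thesis using char_poly_block[of A n 0 n] assms by simp
qed

text \<open>
  This is a fact about characteristic polynomials; it is what makes degrees of products of path
  sums additive and such products nonzero.
\<close>

lemma monic_path_sum:
  assumes "A \<in> carrier_mat n n" "ULH A" "i \<le> j" "j \<le> n"
  shows "degree (path_sum (char_entry A) i j) = j - i" "lead_coeff (path_sum (char_entry A) i j) = 1"
proof -
  have "block A i j \<in> carrier_mat (j - i) (j - i)" by (simp add: block_def)
  from degree_monic_char_poly[OF this]
  show "degree (path_sum (char_entry A) i j) = j - i" "lead_coeff (path_sum (char_entry A) i j) = 1"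
    using char_poly_block[OF assms] by auto
qed

section \<open>Positions of the variables in a companion matrix\<close>

text \<open>
  The part of the definition of a companion matrix that concerns the shape only. It is separated
  from the condition on the characteristic polynomial because every superpattern has it, with
  positions prescribed by the indices.
\<close>

definition companion_layout :: "nat \<Rightarrow> (nat \<Rightarrow> nat \<times> nat) \<Rightarrow> 'a::comm_ring_1 mpoly mat \<Rightarrow> bool" where
  "companion_layout n pos A \<longleftrightarrow> A \<in> carrier_mat n n \<and> inj_on pos {1..n} \<and>
     pos ` {1..n} \<subseteq> {0..<n} \<times> {0..<n} \<and>
     (\<forall>k\<in>{1..n}. A $$ pos k = mvar k) \<and>
     (\<forall>p\<in>{0..<n} \<times> {0..<n} - pos ` {1..n}. \<exists>c. A $$ p = mconst c)"

definition companion_poly :: "nat \<Rightarrow> 'a::comm_ring_1 mpoly poly" where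
  "companion_poly n = monom 1 n - (\<Sum>k=1..n. monom (mvar k) (n - k))"

lemma companion_mat_iff:
  "companion_mat n A \<longleftrightarrow> (\<exists>pos. companion_layout n pos A) \<and> char_poly A = companion_poly n"
  unfolding companion_mat_def companion_layout_def companion_poly_def by blast

lemma companion_poly_split:
  assumes "k \<in> {1..n}"
  shows "companion_poly n = (monom 1 n - (\<Sum>j\<in>{1..n} - {k}. monom (mvar j) (n - j)))
     - Polynomial.smult (mvar k :: 'a::comm_ring_1 mpoly) (monom 1 (n - k))"
proof -
  have "(\<Sum>j=1..n. monom (mvar j :: 'a mpoly) (n - j))
      = monom (mvar k) (n - k) + (\<Sum>j\<in>{1..n} - {k}. monom (mvar j) (n - j))"
    by (rule sum.remove) (use assms in auto)
  then show ?thesis by (simp add: companion_poly_def smult_monom)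
qed

lemma companion_layoutD:
  assumes "companion_layout n pos A"
  shows "A \<in> carrier_mat n n" "inj_on pos {1..n}"
    and "k \<in> {1..n} \<Longrightarrow> pos k = (r, c) \<Longrightarrow> r < n \<and> c < n \<and> A $$ (r, c) = mvar k"
    and "r < n \<Longrightarrow> c < n \<Longrightarrow> (r, c) \<notin> pos ` {1..n} \<Longrightarrow> \<exists>a. A $$ (r, c) = mconst a"
proof -
  show "A \<in> carrier_mat n n" "inj_on pos {1..n}"
    using assms unfolding companion_layout_def by blast+
  show "r < n \<and> c < n \<and> A $$ (r, c) = mvar k" if k: "k \<in> {1..n}" and rc: "pos k = (r, c)"
  proof -
    have "pos k \<in> {0..<n} \<times> {0..<n}" "A $$ pos k = mvar k"
      using assms k unfolding companion_layout_def by blast+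
    then show ?thesis using rc by simp
  qed
  show "\<exists>a. A $$ (r, c) = mconst a" if "r < n" "c < n" "(r, c) \<notin> pos ` {1..n}"
  proof -
    have "(r, c) \<in> {0..<n} \<times> {0..<n} - pos ` {1..n}" using that by simp
    then show ?thesis using assms unfolding companion_layout_def by blast
  qed
qed

lemma layout_on_or_below_diagonal:
  fixes A :: "'a::comm_ring_1 mpoly mat"
  assumes lay: "companion_layout n pos A" and ulh: "ULH A" and k: "k \<in> {1..n}" "pos k = (r, c)"
  shows "c \<le> r" "r < n"
proof -
  have A: "A \<in> carrier_mat n n" and rc: "r < n" "c < n" "A $$ (r, c) = mvar k"
    using companion_layoutD(1,3)[OF lay] k by auto
  have "\<forall>i<n. \<forall>j<n. (j = i + 1 \<longrightarrow> A $$ (i, j) = 1) \<and> (j > i + 1 \<longrightarrow> A $$ (i, j) = 0)"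
    using ulh A unfolding ULH_def by simp
  then have "A $$ (r, c) = 0 \<or> A $$ (r, c) = 1" if "r < c"
    using rc that by (cases "c = r + 1") auto
  then show "c \<le> r"
    using rc mvar_neq_0[of k, where 'a='a] mvar_neq_1[of k, where 'a='a] not_less by metis
  show "r < n" by (rule rc)
qed

lemma layout_entry_var_free:
  fixes A :: "'a::comm_ring_1 mpoly mat"
  assumes lay: "companion_layout n pos A" and rc: "r < n" "c < n" "pos k \<noteq> (r, c)"
  shows "A $$ (r, c) \<in> var_free k"
proof (cases "(r, c) \<in> pos ` {1..n}")
  case True
  then obtain j where j: "j \<in> {1..n}" "pos j = (r, c)" by (metis imageE)
  then have "j \<noteq> k" using rc(3) by blast
  then show ?thesis using companion_layoutD(3)[OF lay j] by (simp add: var_free_mvar)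
next
  case False
  then obtain a where "A $$ (r, c) = mconst a"
    using companion_layoutD(4)[OF lay rc(1,2)] by blast
  then show ?thesis by simp
qed

lemma char_entry_var_free:
  "A $$ (r, c) \<in> var_free k \<Longrightarrow> char_entry A r c \<in> coeffs_var_free k"
  for A :: "'a::comm_ring_1 mpoly mat"
  unfolding char_entry_def
  by (intro coeffs_var_free_diff) (auto intro!: coeffs_var_free_pCons)

text \<open>
  The coefficient of a variable at position \<open>(r, c)\<close> in the characteristic polynomial
  of a block is, up to sign, the product of the characteristic polynomials of the blocks before
  column \<open>c\<close> and after row \<open>r\<close>: the paths through the step from
  \<open>c\<close> to \<open>r + 1\<close> split there. Any affine representation of the
  characteristic polynomial must therefore have this coefficient.
\<close>

lemma coefficient_of_variable:
  fixes A :: "'a::comm_ring_1 mpoly mat"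
  assumes lay: "companion_layout n pos A" and k: "k \<in> {1..n}" "pos k = (r, c)"
    and ij: "i \<le> c" "c \<le> r" "r < j" "j \<le> n"
    and eq: "path_sum (char_entry A) i j = u - Polynomial.smult (mvar k) v"
    and u: "u \<in> coeffs_var_free k"
  shows "path_sum (char_entry A) i c * path_sum (char_entry A) (Suc r) j = v"
proof -
  let ?b = "char_entry A"
  let ?b' = "\<lambda>r' c'. if r' = r \<and> c' = c then ?b r c - [:- mvar k:] else ?b r' c'"
  let ?w = "path_sum ?b i c * path_sum ?b (Suc r) j"
  have Arc: "A $$ (r, c) = mvar k" using companion_layoutD(3)[OF lay k] by simp
  have "?b' r' c' \<in> coeffs_var_free k" if "i \<le> c'" "c' \<le> r'" "r' < j" for r' c'
  proof (cases "r' = r \<and> c' = c")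
    case True
    then show ?thesis
      by (auto simp: char_entry_def Arc intro!: coeffs_var_free_pCons)
  next
    case False
    then show ?thesis
      using layout_entry_var_free[OF lay, of r' c' k] k(2) that ij(4)
      by (auto intro!: char_entry_var_free)
  qed
  then have "path_sum ?b' i j \<in> coeffs_var_free k"
    by (rule path_sum_closed) (auto intro: coeffs_var_free_add coeffs_var_free_mult)
  moreover have "path_sum ?b i j = path_sum ?b' i j - Polynomial.smult (mvar k) ?w"
    using path_sum_perturb_single[OF ij(1-3), of ?b "[:- mvar k:]"] by simp
  ultimately show ?thesis
    using mvar_coefficient_unique[of "path_sum ?b' i j" k ?w u v] eq u by simp
qed

lemma companion_poly_blocks:
  fixes A :: "'a::comm_ring_1 mpoly mat"
  assumes lay: "companion_layout n pos A" and "ULH A" and k: "k \<in> {1..n}" "pos k = (r, c)"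
    and cp: "char_poly A = companion_poly n"
  shows "path_sum (char_entry A) 0 c * path_sum (char_entry A) (Suc r) n = monom 1 (n - k)"
proof (rule coefficient_of_variable[OF lay k])
  have A: "A \<in> carrier_mat n n" by (rule companion_layoutD(1)[OF lay])
  show "path_sum (char_entry A) 0 n = (monom 1 n - (\<Sum>j\<in>{1..n} - {k}. monom (mvar j) (n - j)))
     - Polynomial.smult (mvar k) (monom 1 (n - k))"
    using cp char_poly_eq_path_sum[OF A assms(2)] companion_poly_split[OF k(1)] by simp
  show "monom 1 n - (\<Sum>j\<in>{1..n} - {k}. monom (mvar j :: 'a mpoly) (n - j)) \<in> coeffs_var_free k"
    by (intro coeffs_var_free_diff coeffs_var_free_monom coeffs_var_free_sum) (auto simp: var_free_mvar)
qed (use layout_on_or_below_diagonal[OF assms(1-4)] in auto)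

text \<open>
  The two monic factors multiply to a power of the indeterminate, so each of them is a power of
  it, and comparing degrees puts the variable with index \<open>k\<close> on the subdiagonal
  number \<open>k - 1\<close>.
\<close>

lemma companion_blocks_monom:
  fixes A :: "'a::field mpoly mat"
  assumes lay: "companion_layout n pos A" and ulh: "ULH A" and k: "k \<in> {1..n}" "pos k = (r, c)"
    and cp: "char_poly A = companion_poly n"
  shows "k + c = Suc r" "path_sum (char_entry A) 0 c = monom 1 c"
    "path_sum (char_entry A) (Suc r) n = monom 1 (n - Suc r)"
proof -
  have A: "A \<in> carrier_mat n n" by (rule companion_layoutD(1)[OF lay])
  have rc: "c \<le> r" "r < n" using layout_on_or_below_diagonal[OF lay ulh k] by auto
  let ?L = "path_sum (char_entry A) 0 c" and ?R = "path_sum (char_entry A) (Suc r) n"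
  have prod: "?L * ?R = monom 1 (n - k)"
    by (rule companion_poly_blocks[OF lay ulh k cp])
  have L: "degree ?L = c" "lead_coeff ?L = 1" and R: "degree ?R = n - Suc r" "lead_coeff ?R = 1"
    using monic_path_sum[OF A ulh, of 0 c] monic_path_sum[OF A ulh, of "Suc r" n] rc by simp_all
  have "?L \<noteq> 0" "?R \<noteq> 0" using L R by auto
  then have "c + (n - Suc r) = n - k"
    using arg_cong[OF prod, of degree] L R by (simp add: degree_mult_eq degree_monom_eq)
  then show "k + c = Suc r" using k(1) rc by auto
  show "?L = monom 1 c" using monic_mult_eq_monom[OF prod L(2) R(2)] L(1) by simp
  have "?R * ?L = monom 1 (n - k)" using prod by (simp add: mult.commute)
  then show "?R = monom 1 (n - Suc r)" using monic_mult_eq_monom[OF _ R(2) L(2)] R(1) by simp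
qed

text \<open>
  The block that ends before column \<open>c\<close> has a characteristic polynomial without
  variables. If it contained the diagonal position of \<open>x\<^sub>1\<close>, the coefficient of
  \<open>x\<^sub>1\<close> in it would be a product of monic polynomials, hence nonzero. The block
  after row \<open>r\<close> is treated in the same way.
\<close>

lemma companion_layout_crosses:
  fixes A :: "'a::field mpoly mat"
  assumes lay: "companion_layout n pos A" and ulh: "ULH A" and k: "k \<in> {1..n}" "pos k = (r, c)"
    and cp: "char_poly A = companion_poly n" and p1: "pos 1 = (s, s)"
  shows "c \<le> s" "s \<le> r"
proof -
  have A: "A \<in> carrier_mat n n" by (rule companion_layoutD(1)[OF lay])
  have one: "1 \<in> {1..n}" using k by auto
  have rc: "c \<le> r" "r < n" using layout_on_or_below_diagonal[OF lay ulh k] by auto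
  have s: "s < n" using layout_on_or_below_diagonal[OF lay ulh one p1] by auto
  have absurd: False
    if "i \<le> s" "s < j" "j \<le> n" "path_sum (char_entry A) i j = monom 1 (j - i)" for i j
  proof -
    have "path_sum (char_entry A) i s * path_sum (char_entry A) (Suc s) j = 0"
      by (rule coefficient_of_variable[OF lay one p1, where u = "monom 1 (j - i)"])
         (use that in \<open>auto intro: coeffs_var_free_monom\<close>)
    moreover have "path_sum (char_entry A) i s \<noteq> 0" "path_sum (char_entry A) (Suc s) j \<noteq> 0"
      using monic_path_sum(2)[OF A ulh, of i s] monic_path_sum(2)[OF A ulh, of "Suc s" j] that s
      by (force simp del: leading_coeff_0_iff)+
    ultimately show False by simp
  qed
  show "c \<le> s"
    using absurd[of 0 c] companion_blocks_monom(2)[OF lay ulh k cp] rc by force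
  show "s \<le> r"
    using absurd[of "Suc r" n] companion_blocks_monom(3)[OF lay ulh k cp] rc s by force
qed

text \<open>
  The indices \<open>ix k\<close> are read off from the rows of the variables. That they are
  admissible is what the two preceding lemmas say.
\<close>

lemma companion_ULH_in_C_tilde_class:
  fixes A :: "'a::field mpoly mat"
  assumes n: "1 \<le> n" and comp: "companion_mat n A" and ulh: "ULH A"
  shows "A \<in> C_tilde_class"
proof -
  obtain pos where lay: "companion_layout n pos A" and cp: "char_poly A = companion_poly n"
    using comp by (auto simp: companion_mat_iff)
  have A: "A \<in> carrier_mat n n" by (rule companion_layoutD(1)[OF lay])
  define ix where "ix k = Suc (fst (pos k))" for k
  have shift: "k + snd (pos k) = ix k" if "k \<in> {1..n}" for k
    using companion_blocks_monom(1)[OF lay ulh that _ cp, of "fst (pos k)" "snd (pos k)"] by (simp add: ix_def)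
  have p1: "pos 1 = (fst (pos 1), fst (pos 1))"
    using shift[of 1] n by (simp add: ix_def prod_eq_iff)
  have pos: "pos k = (ix k - 1, ix k - k)" if "k \<in> {1..n}" for k
    using shift[OF that] by (simp add: ix_def prod_eq_iff)
  have valid: "valid_indices n ix"
    unfolding valid_indices_def
  proof (intro conjI ballI)
    fix k assume k: "k \<in> {1..n}"
    have "snd (pos k) \<le> fst (pos 1)" "fst (pos 1) \<le> fst (pos k)"
      using companion_layout_crosses[OF lay ulh k _ cp p1, of "fst (pos k)" "snd (pos k)"] by auto
    moreover have "fst (pos k) < n"
      using layout_on_or_below_diagonal[OF lay ulh k, of "fst (pos k)" "snd (pos k)"] by auto
    ultimately show "k \<le> ix k" "ix k \<le> n" "ix k - k + 1 \<le> ix 1" "ix 1 \<le> ix k"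
      using shift[OF k] by (auto simp: ix_def)
  qed (use n in simp)
  have "A $$ (i, j) = C_mat n ix $$ (i, j) \<or>
      (j \<le> i \<and> C_mat n ix $$ (i, j) = (0 :: 'a mpoly) \<and> (\<exists>c. c \<noteq> 0 \<and> A $$ (i, j) = mconst c))"
    if ij: "i < n" "j < n" for i j
  proof (cases "i < j")
    case True
    then show ?thesis using ulh ij A unfolding ULH_def by (auto simp: C_mat_def)
  next
    case False
    define k where "k = i - j + 1"
    have k: "k \<in> {1..n}" using ij False by (auto simp: k_def)
    show ?thesis
    proof (cases "ix k = i + 1")
      case True
      then have "pos k = (i, j)" using pos[OF k] False by (auto simp: k_def)
      then have "A $$ (i, j) = mvar k" using companion_layoutD(3)[OF lay k] by simp
      then show ?thesis using True False ij by (simp add: C_mat_def k_def)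
    next
      case neq: False
      then have C0: "C_mat n ix $$ (i, j) = (0 :: 'a mpoly)"
        using False ij by (simp add: C_mat_def k_def)
      have "(i, j) \<notin> pos ` {1..n}"
      proof
        assume "(i, j) \<in> pos ` {1..n}"
        then obtain k' where k': "k' \<in> {1..n}" "pos k' = (i, j)" by auto
        then have "k' = k" "ix k' = i + 1" using shift[of k'] by (auto simp: ix_def k_def)
        then show False using neq by simp
      qed
      then obtain a where "A $$ (i, j) = mconst a"
        using companion_layoutD(4)[OF lay ij] by blast
      then show ?thesis using C0 False by (cases "a = 0") auto
    qed
  qed
  then have "A \<in> ULH_superpatterns (C_mat n ix)"
    using A by (auto simp: ULH_superpatterns_def C_mat_def)
  then show ?thesis using valid by (auto simp: C_tilde_class_def C_class_def)
qed

text \<open>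
  Only zeros are changed in a superpattern, and only to constants, so the variables stay where the
  indices put them.
\<close>

lemma superpattern_layout:
  fixes A :: "'a::comm_ring_1 mpoly mat"
  assumes valid: "valid_indices n ix" and A: "A \<in> ULH_superpatterns (C_mat n ix)"
  shows "ULH A" "companion_layout n (\<lambda>k. (ix k - 1, ix k - k)) A"
proof -
  have carr: "A \<in> carrier_mat n n" and
    entry: "\<And>i j. i < n \<Longrightarrow> j < n \<Longrightarrow> A $$ (i, j) = C_mat n ix $$ (i, j) \<or>
        (j \<le> i \<and> C_mat n ix $$ (i, j) = (0 :: 'a mpoly) \<and> (\<exists>c. c \<noteq> 0 \<and> A $$ (i, j) = mconst c))"
    using A by (auto simp: ULH_superpatterns_def C_mat_def)
  have "A $$ (i, j) = C_mat n ix $$ (i, j)" if "i < n" "j < n" "i < j" for i j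
    using entry[OF that(1,2)] that(3) by auto
  then show "ULH A" using carr by (auto simp: ULH_def C_mat_def)
  have ix: "1 \<le> k" "k \<le> ix k" "ix k \<le> n" if "k \<in> {1..n}" for k
    using valid that by (auto simp: valid_indices_def)
  show "companion_layout n (\<lambda>k. (ix k - 1, ix k - k)) A"
    unfolding companion_layout_def
  proof (intro conjI ballI)
    show "inj_on (\<lambda>k. (ix k - 1, ix k - k)) {1..n}"
    proof (rule inj_onI)
      fix k l assume "k \<in> {1..n}" "l \<in> {1..n}" "(ix k - 1, ix k - k) = (ix l - 1, ix l - l)"
      then show "k = l" using ix[of k] ix[of l] by auto
    qed
    show "(\<lambda>k. (ix k - 1, ix k - k)) ` {1..n} \<subseteq> {0..<n} \<times> {0..<n}"
    proof (rule image_subsetI)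
      fix k assume "k \<in> {1..n}"
      then show "(ix k - 1, ix k - k) \<in> {0..<n} \<times> {0..<n}" using ix[of k] by auto
    qed
  next
    fix k assume k: "k \<in> {1..n}"
    have "C_mat n ix $$ (ix k - 1, ix k - k) = (mvar k :: 'a mpoly)"
      using C_mat_var[OF valid k] by simp
    moreover have "ix k - 1 < n" "ix k - k < n" using ix[OF k] by auto
    ultimately show "A $$ (ix k - 1, ix k - k) = mvar k"
      using entry[of "ix k - 1" "ix k - k"] mvar_neq_0[of k, where 'a='a] by auto
  next
    fix p assume p: "p \<in> {0..<n} \<times> {0..<n} - (\<lambda>k. (ix k - 1, ix k - k)) ` {1..n}"
    obtain i j where ij: "p = (i, j)" "i < n" "j < n" using p by auto
    have "ix (i - j + 1) \<noteq> i + 1" if "j \<le> i"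
    proof
      assume eq: "ix (i - j + 1) = i + 1"
      have "i - j + 1 \<in> {1..n}" "(ix (i - j + 1) - 1, ix (i - j + 1) - (i - j + 1)) = (i, j)"
        using ij that eq by auto
      then have "(i, j) \<in> (\<lambda>k. (ix k - 1, ix k - k)) ` {1..n}" by (metis (no_types, lifting) image_eqI)
      then show False using p ij by blast
    qed
    then have "C_mat n ix $$ (i, j) = (1 :: 'a mpoly) \<or> C_mat n ix $$ (i, j) = (0 :: 'a mpoly)"
      using ij by (auto simp: C_mat_def)
    then have "C_mat n ix $$ (i, j) = (mconst 1 :: 'a mpoly) \<or> C_mat n ix $$ (i, j) = (mconst 0 :: 'a mpoly)"
      by simp
    then show "\<exists>c. A $$ p = mconst c" using entry[OF ij(2,3)] ij(1) by metis
  qed (rule carr)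
qed

section \<open>Expansion along the variables of a superpattern\<close>

lemma constant_part_altdef:
  "constant_part A = map_mat (\<lambda>p. Poly_Mapping.lookup p 0) A" for A :: "'a::comm_semiring_1 mpoly mat"
proof -
  have "meval (\<lambda>_. 0) = (\<lambda>p :: 'a mpoly. Poly_Mapping.lookup p 0)"
    by (rule ext) (rule meval_zero)
  then show ?thesis by (simp add: constant_part_def)
qed

text \<open>
  The constant part, regarded again as a matrix over the polynomial ring, where it can be compared
  with \<open>A\<close> itself.
\<close>

definition drop_variables :: "'a::comm_ring_1 mpoly mat \<Rightarrow> 'a mpoly mat" where
  "drop_variables A = map_mat mconst (constant_part A)"

lemma drop_variables_carrier [simp]: "A \<in> carrier_mat n n \<Longrightarrow> drop_variables A \<in> carrier_mat n n"
  by (simp add: drop_variables_def constant_part_def)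

lemma drop_variables_index:
  "A \<in> carrier_mat n n \<Longrightarrow> r < n \<Longrightarrow> c < n \<Longrightarrow>
   drop_variables A $$ (r, c) = mconst (Poly_Mapping.lookup (A $$ (r, c)) 0)"
  by (simp add: drop_variables_def constant_part_altdef)

lemma ULH_drop_variables:
  fixes A :: "'a::comm_ring_1 mpoly mat"
  assumes "A \<in> carrier_mat n n" "ULH A"
  shows "ULH (drop_variables A)"
proof -
  have "dim_row A = n" "dim_row (drop_variables A) = n" "dim_col (drop_variables A) = n"
    using carrier_matD[OF assms(1)] carrier_matD[OF drop_variables_carrier[OF assms(1)]] by auto
  then show ?thesis
    using assms(2) by (auto simp: ULH_def drop_variables_index[OF assms(1)] lookup_one)
qed

lemma char_poly_drop_variables:
  assumes "A \<in> carrier_mat n n"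
  shows "char_poly (drop_variables A) = map_poly mconst (char_poly (constant_part A))"
  unfolding drop_variables_def
  by (rule comm_ring_hom.char_poly_hom[OF comm_ring_hom_mconst, of _ n])
     (use assms in \<open>simp add: constant_part_def\<close>)

lemma char_poly_constant_part:
  assumes "A \<in> carrier_mat n n"
  shows "char_poly (constant_part A) = map_poly (\<lambda>p. Poly_Mapping.lookup p 0) (char_poly A)"
  unfolding constant_part_altdef
  by (rule comm_ring_hom.char_poly_hom[OF comm_ring_hom_constant_term assms])

lemma constant_term_companion_poly:
  "map_poly (\<lambda>p. Poly_Mapping.lookup p 0) (companion_poly n :: 'a::comm_ring_1 mpoly poly) = monom 1 n"
proof (rule poly_eqI)
  fix i
  have "Poly_Mapping.lookup (coeff (monom (mvar k :: 'a mpoly) (n - k)) i) 0 = 0" for k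
    by simp
  then show "coeff (map_poly (\<lambda>p. Poly_Mapping.lookup p 0) (companion_poly n :: 'a mpoly poly)) i
      = coeff (monom 1 n) i"
    by (simp add: coeff_map_poly companion_poly_def coeff_sum lookup_minus lookup_sum lookup_one)
qed

lemma drop_variables_entry:
  fixes A :: "'a::comm_ring_1 mpoly mat"
  assumes lay: "companion_layout n pos A" and "r < n" "c < n"
  shows "k \<in> {1..n} \<Longrightarrow> pos k = (r, c) \<Longrightarrow> drop_variables A $$ (r, c) = 0"
    and "(r, c) \<notin> pos ` {1..n} \<Longrightarrow> drop_variables A $$ (r, c) = A $$ (r, c)"
proof -
  have A: "A \<in> carrier_mat n n" by (rule companion_layoutD(1)[OF lay])
  note idx = drop_variables_index[OF A assms(2,3)]
  show "drop_variables A $$ (r, c) = 0" if "k \<in> {1..n}" "pos k = (r, c)"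
  proof -
    have "A $$ (r, c) = mvar k" using companion_layoutD(3)[OF lay that] by simp
    then show ?thesis by (simp add: idx)
  qed
  show "drop_variables A $$ (r, c) = A $$ (r, c)" if notin: "(r, c) \<notin> pos ` {1..n}"
  proof -
    obtain a where "A $$ (r, c) = mconst a"
      using companion_layoutD(4)[OF lay assms(2,3) notin] by blast
    then show ?thesis by (simp add: idx lookup_mconst)
  qed
qed

lemma path_sum_drop_variables:
  fixes A :: "'a::comm_ring_1 mpoly mat"
  assumes lay: "companion_layout n pos A" and "j \<le> n"
    and "\<And>k. k \<in> {1..n} \<Longrightarrow> \<not> (i \<le> snd (pos k) \<and> fst (pos k) < j)"
  shows "path_sum (char_entry (drop_variables A)) i j = path_sum (char_entry A) i j"
proof (rule path_sum_cong)
  fix r c assume rc: "i \<le> c" "c \<le> r" "r < j"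
  have "(r, c) \<notin> pos ` {1..n}"
  proof
    assume "(r, c) \<in> pos ` {1..n}"
    then obtain k where "k \<in> {1..n}" "pos k = (r, c)" by (metis imageE)
    then show False using assms(3)[of k] rc by simp
  qed
  then show "char_entry (drop_variables A) r c = char_entry A r c"
    using drop_variables_entry(2)[OF lay, of r c] rc assms(2) by (simp add: char_entry_def)
qed

text \<open>
  If all variables lie in one corner block, then no path uses two of them, so the characteristic
  polynomial is affine in all variables jointly, with coefficients as in
  \<open>coefficient_of_variable\<close>.
\<close>

lemma char_poly_layout_expansion:
  fixes A :: "'a::comm_ring_1 mpoly mat"
  assumes lay: "companion_layout n pos A" and ulh: "ULH A" and s: "s < n"
    and corner: "\<And>k. k \<in> {1..n} \<Longrightarrow> snd (pos k) \<le> s \<and> s \<le> fst (pos k)"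
  shows "char_poly A = char_poly (drop_variables A) -
    (\<Sum>k=1..n. Polynomial.smult (mvar k)
       (path_sum (char_entry A) 0 (snd (pos k)) * path_sum (char_entry A) (Suc (fst (pos k))) n))"
proof -
  have A: "A \<in> carrier_mat n n" by (rule companion_layoutD(1)[OF lay])
  let ?b = "char_entry A" and ?d = "char_entry (drop_variables A)"
  let ?F = "\<lambda>(r, c). path_sum ?b 0 c * (?b r c - ?d r c) * path_sum ?b (Suc r) n"
  have off: "?b r c = ?d r c" if "(r, c) \<notin> pos ` {1..n}" "r < n" "c < n" for r c
    using drop_variables_entry(2)[OF lay, of r c] that by (simp add: char_entry_def)
  have bound: "fst (pos k) < n" "snd (pos k) < n" if "k \<in> {1..n}" for k
    using companion_layoutD(3)[OF lay that, of "fst (pos k)" "snd (pos k)"] by auto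
  have "path_sum ?b 0 n = path_sum ?d 0 n +
     (\<Sum>c\<in>{0..s}. \<Sum>r\<in>{s..<n}. path_sum ?b 0 c * (?b r c - ?d r c) * path_sum ?b (Suc r) n)"
  proof (rule path_sum_perturb)
    fix r c assume rc: "\<not> (c \<le> s \<and> s \<le> r)" "c \<le> r" "r < n"
    have "(r, c) \<notin> pos ` {1..n}"
    proof
      assume "(r, c) \<in> pos ` {1..n}"
      then obtain k where "k \<in> {1..n}" "pos k = (r, c)" by (metis imageE)
      then show False using corner[of k] rc(1) by simp
    qed
    then show "?b r c = ?d r c" using off rc by simp
  qed (use s in auto)
  also have "(\<Sum>c\<in>{0..s}. \<Sum>r\<in>{s..<n}. path_sum ?b 0 c * (?b r c - ?d r c) * path_sum ?b (Suc r) n)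
    = sum ?F ({s..<n} \<times> {0..s})"
    by (subst sum.swap) (simp add: sum.cartesian_product)
  also have "\<dots> = sum ?F (pos ` {1..n})"
  proof (rule sum.mono_neutral_right)
    show "pos ` {1..n} \<subseteq> {s..<n} \<times> {0..s}"
    proof (rule image_subsetI)
      fix k assume k: "k \<in> {1..n}"
      show "pos k \<in> {s..<n} \<times> {0..s}" using corner[OF k] bound[OF k] by (simp add: mem_Times_iff)
    qed
    show "\<forall>p\<in>{s..<n} \<times> {0..s} - pos ` {1..n}. ?F p = 0"
    proof
      fix p assume p: "p \<in> {s..<n} \<times> {0..s} - pos ` {1..n}"
      obtain r c where rc: "p = (r, c)" by force
      have "char_entry A r c = char_entry (drop_variables A) r c"
        using off[of r c] p rc s by simp
      then show "?F p = 0" by (simp add: rc)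
    qed
  qed simp
  also have "\<dots> = (\<Sum>k=1..n. ?F (pos k))"
    by (subst sum.reindex[OF companion_layoutD(2)[OF lay]]) simp
  also have "\<dots> = - (\<Sum>k=1..n. Polynomial.smult (mvar k)
       (path_sum (char_entry A) 0 (snd (pos k)) * path_sum (char_entry A) (Suc (fst (pos k))) n))"
    unfolding sum_negf[symmetric]
  proof (rule sum.cong[OF refl])
    fix k assume k: "k \<in> {1..n}"
    obtain r c where rc: "pos k = (r, c)" by force
    have "A $$ (r, c) = mvar k" using companion_layoutD(3)[OF lay k rc] by simp
    moreover have "drop_variables A $$ (r, c) = 0"
      using drop_variables_entry(1)[OF lay _ _ k rc] bound[OF k] rc by simp
    ultimately have "?b r c - ?d r c = [:- mvar k:]" by (simp add: char_entry_def)
    then show "?F (pos k) = - Polynomial.smult (mvar k)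
       (path_sum (char_entry A) 0 (snd (pos k)) * path_sum (char_entry A) (Suc (fst (pos k))) n)"
      by (simp add: rc)
  qed
  finally show ?thesis
    using char_poly_eq_path_sum[OF A ulh]
      char_poly_eq_path_sum[OF drop_variables_carrier[OF A] ULH_drop_variables[OF A ulh]] by simp
qed

text \<open>
  If the corner block vanishes, the only crossing step that survives is the diagonal one, whose
  weight is the indeterminate.
\<close>

lemma char_poly_zero_corner:
  fixes A :: "'a::comm_ring_1 mat"
  assumes A: "A \<in> carrier_mat n n" and ulh: "ULH A" and s: "s < n"
    and zero: "\<And>r c. c \<le> s \<Longrightarrow> s \<le> r \<Longrightarrow> r < n \<Longrightarrow> A $$ (r, c) = 0"
  shows "char_poly A = monom 1 1 * (path_sum (char_entry A) 0 s * path_sum (char_entry A) (Suc s) n)"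
proof -
  let ?b = "char_entry A"
  have "(\<Sum>r\<in>{s..<n}. path_sum ?b 0 c * ?b r c * path_sum ?b (Suc r) n)
    = (if c = s then monom 1 1 * (path_sum ?b 0 s * path_sum ?b (Suc s) n) else 0)" if c: "c \<in> {0..s}" for c
  proof -
    have "(\<Sum>r\<in>{s..<n}. path_sum ?b 0 c * ?b r c * path_sum ?b (Suc r) n)
      = (\<Sum>r\<in>{s..<n}. if r = s then
           (if c = s then monom 1 1 * (path_sum ?b 0 s * path_sum ?b (Suc s) n) else 0) else 0)"
      using c zero by (intro sum.cong refl) (auto simp: char_entry_def monom_Suc monom_0)
    then show ?thesis using s by simp
  qed
  then have "(\<Sum>c\<in>{0..s}. \<Sum>r\<in>{s..<n}. path_sum ?b 0 c * ?b r c * path_sum ?b (Suc r) n)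
      = monom 1 1 * (path_sum ?b 0 s * path_sum ?b (Suc s) n)" by simp
  then show ?thesis
    using char_poly_eq_path_sum[OF A ulh] path_sum_crossing[of 0 s n ?b] s by simp
qed

text \<open>
  A block without variables is constant for free, and the empty block has characteristic
  polynomial 1; so each of the conditions on principal submatrices just says that a path sum is a
  power of the indeterminate.
\<close>

lemma block_condition_iff:
  fixes A :: "'a::field mpoly mat"
  assumes lay: "companion_layout n pos A" and ulh: "ULH A" and ij: "i \<le> j" "j \<le> n"
    and "\<And>k. k \<in> {1..n} \<Longrightarrow> \<not> (i \<le> snd (pos k) \<and> fst (pos k) < j)"
  shows "(let B = principal_submatrix A (Suc i) j in (constant_mat B \<and> nilpotent_mat B) \<or> empty_mat B)
     \<longleftrightarrow> path_sum (char_entry A) i j = monom 1 (j - i)"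
proof -
  have A: "A \<in> carrier_mat n n" by (rule companion_layoutD(1)[OF lay])
  have B: "block A i j \<in> carrier_mat (j - i) (j - i)" by (simp add: block_def)
  have "constant_mat (block A i j)"
    unfolding constant_mat_def
  proof (intro allI impI)
    fix r c assume "r < dim_row (block A i j)" "c < dim_col (block A i j)"
    then have rc: "r < j - i" "c < j - i" by (auto simp: block_def)
    have "(i + r, i + c) \<notin> pos ` {1..n}"
    proof
      assume "(i + r, i + c) \<in> pos ` {1..n}"
      then obtain k where "k \<in> {1..n}" "pos k = (i + r, i + c)" by (metis imageE)
      then show False using assms(5)[of k] rc by simp
    qed
    then show "\<exists>a. block A i j $$ (r, c) = mconst a"
      using companion_layoutD(4)[OF lay, of "i + r" "i + c"] rc ij by (simp add: block_def)
  qed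
  moreover have "nilpotent_mat (block A i j) \<longleftrightarrow> path_sum (char_entry A) i j = monom 1 (j - i)"
    using nilpotent_iff_char_poly[OF B] char_poly_block[OF A ulh ij] by simp
  moreover have "path_sum (char_entry A) i j = monom 1 (j - i)" if "empty_mat (block A i j)"
    using that by (simp add: empty_mat_def block_def monom_0 one_pCons)
  ultimately show ?thesis
    using principal_submatrix_eq_block[OF A ij(2), of i] by (auto simp: Let_def)
qed

text \<open>
  Necessity of the block conditions is \<open>companion_blocks_monom\<close>, and nilpotency of
  the constant part follows by setting all variables to 0. Conversely, the expansion along the
  variables turns the block conditions into the required coefficients, and nilpotency of the
  constant part into the required leading power. If the constant part vanishes on the corner
  block, the block conditions for \<open>k = 1\<close> already determine its characteristic
  polynomial.
\<close>

lemma companion_iff_blocks: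
  fixes A :: "'a::field mpoly mat"
  assumes valid: "valid_indices n ix" and A: "A \<in> ULH_superpatterns (C_mat n ix)"
  defines "Q \<equiv> (\<forall>k\<in>{1..n}. let B = principal_submatrix A 1 (ix k - k)
              in (constant_mat B \<and> nilpotent_mat B) \<or> empty_mat B) \<and>
           (\<forall>k\<in>{1..n}. let B = principal_submatrix A (ix k + 1) n
              in (constant_mat B \<and> nilpotent_mat B) \<or> empty_mat B)"
  shows "companion_mat n A \<longleftrightarrow> nilpotent_mat (constant_part A) \<and> Q"
    and "elements_mat (corner_block A (ix 1)) - {0} = mvar ` {1..n} \<Longrightarrow> Q \<Longrightarrow> nilpotent_mat (constant_part A)"
proof -
  define pos where "pos k = (ix k - 1, ix k - k)" for k
  define s where "s = ix 1 - 1"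
  let ?b = "char_entry A"
  have ulh: "ULH A" and lay: "companion_layout n pos A"
    using superpattern_layout[OF valid A] by (simp_all add: pos_def[abs_def])
  have carr: "A \<in> carrier_mat n n" by (rule companion_layoutD(1)[OF lay])
  have ix: "1 \<le> k" "k \<le> ix k" "ix k \<le> n" "ix k - k \<le> s" "s < ix k" if "k \<in> {1..n}" for k
    using valid that by (force simp: valid_indices_def s_def)+
  have one: "1 \<in> {1..n}" using valid by (simp add: valid_indices_def)
  have s: "s < n" "ix 1 = Suc s" using ix[OF one] by auto
  \<comment> \<open>every variable lies in a row from \<open>s\<close> on and in a column up to \<open>s\<close>, so the blocks before
    column \<open>ix k - k\<close> and after row \<open>ix k - 1\<close> contain none\<close>
  have Q: "Q \<longleftrightarrow> (\<forall>k\<in>{1..n}. path_sum ?b 0 (ix k - k) = monom 1 (ix k - k) \<and>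
      path_sum ?b (ix k) n = monom 1 (n - ix k))"
  proof -
    have "(let B = principal_submatrix A (Suc 0) (ix k - k) in (constant_mat B \<and> nilpotent_mat B) \<or> empty_mat B)
       \<longleftrightarrow> path_sum ?b 0 (ix k - k) = monom 1 (ix k - k - 0)"
      "(let B = principal_submatrix A (Suc (ix k)) n in (constant_mat B \<and> nilpotent_mat B) \<or> empty_mat B)
       \<longleftrightarrow> path_sum ?b (ix k) n = monom 1 (n - ix k)" if k: "k \<in> {1..n}" for k
    proof -
      have "\<not> fst (pos l) < ix k - k" "\<not> ix k \<le> snd (pos l)" if "l \<in> {1..n}" for l
        using ix[OF k] ix[OF that] by (auto simp: pos_def)
      then show "(let B = principal_submatrix A (Suc 0) (ix k - k) in (constant_mat B \<and> nilpotent_mat B) \<or> empty_mat B)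
       \<longleftrightarrow> path_sum ?b 0 (ix k - k) = monom 1 (ix k - k - 0)"
      "(let B = principal_submatrix A (Suc (ix k)) n in (constant_mat B \<and> nilpotent_mat B) \<or> empty_mat B)
       \<longleftrightarrow> path_sum ?b (ix k) n = monom 1 (n - ix k)"
        using ix[OF k] by (intro block_condition_iff[OF lay ulh]; auto)+
    qed
    then show ?thesis unfolding Q_def by (simp add: ball_conj_distrib)
  qed
  have expansion: "char_poly A = char_poly (drop_variables A) - (\<Sum>k=1..n. monom (mvar k) (n - k))" if Q
  proof -
    have "char_poly A = char_poly (drop_variables A) -
      (\<Sum>k=1..n. Polynomial.smult (mvar k)
         (path_sum ?b 0 (snd (pos k)) * path_sum ?b (Suc (fst (pos k))) n))"
      by (rule char_poly_layout_expansion[OF lay ulh s(1)]) (use ix in \<open>force simp: pos_def\<close>)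
    also have "(\<Sum>k=1..n. Polynomial.smult (mvar k)
         (path_sum ?b 0 (snd (pos k)) * path_sum ?b (Suc (fst (pos k))) n)) = (\<Sum>k=1..n. monom (mvar k) (n - k))"
    proof (rule sum.cong[OF refl])
      fix k assume k: "k \<in> {1..n}"
      have "snd (pos k) = ix k - k" "Suc (fst (pos k)) = ix k" "ix k - k + (n - ix k) = n - k"
        using ix[OF k] by (auto simp: pos_def)
      moreover have "path_sum ?b 0 (ix k - k) = monom 1 (ix k - k)" "path_sum ?b (ix k) n = monom 1 (n - ix k)"
        using that Q k by auto
      ultimately show "Polynomial.smult (mvar k)
         (path_sum ?b 0 (snd (pos k)) * path_sum ?b (Suc (fst (pos k))) n) = monom (mvar k) (n - k)"
        by (simp add: mult_monom smult_monom)
    qed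
    finally show ?thesis .
  qed
  have nil: "nilpotent_mat (constant_part A) \<longleftrightarrow> char_poly (constant_part A) = monom 1 n"
    by (rule nilpotent_iff_char_poly) (use carr in \<open>simp add: constant_part_def\<close>)
  show "companion_mat n A \<longleftrightarrow> nilpotent_mat (constant_part A) \<and> Q"
  proof
    assume "companion_mat n A"
    then have cp: "char_poly A = companion_poly n" by (simp add: companion_mat_iff)
    have "path_sum ?b 0 (ix k - k) = monom 1 (ix k - k) \<and> path_sum ?b (ix k) n = monom 1 (n - ix k)"
      if k: "k \<in> {1..n}" for k
      using companion_blocks_monom(2,3)[OF lay ulh k pos_def cp] ix[OF k] by simp
    then have Q unfolding Q by blast
    moreover have "char_poly (constant_part A) = monom 1 n"
      using char_poly_constant_part[OF carr] cp constant_term_companion_poly by simp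
    ultimately show "nilpotent_mat (constant_part A) \<and> Q" using nil by simp
  next
    assume "nilpotent_mat (constant_part A) \<and> Q"
    then have "char_poly (constant_part A) = monom 1 n" Q using nil by auto
    then have "char_poly A = companion_poly n"
      using expansion char_poly_drop_variables[OF carr]
      by (simp add: companion_poly_def map_poly_monom)
    then show "companion_mat n A" using lay by (auto simp: companion_mat_iff)
  qed
  show "nilpotent_mat (constant_part A)"
    if elems: "elements_mat (corner_block A (ix 1)) - {0} = mvar ` {1..n}" and Q
  proof -
    have zero: "drop_variables A $$ (r, c) = 0" if "c \<le> s" "s \<le> r" "r < n" for r c
    proof -
      have "A $$ (r, c) \<in> insert 0 (mvar ` {1..n})"
        using elements_corner_block[OF carr that] elems s(2) by auto
      then show ?thesis using that by (auto simp: drop_variables_index[OF carr])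
    qed
    have "\<not> fst (pos l) < s" "\<not> Suc s \<le> snd (pos l)" if "l \<in> {1..n}" for l
      using ix[OF that] by (auto simp: pos_def)
    then have "path_sum (char_entry (drop_variables A)) 0 s = path_sum ?b 0 s"
      "path_sum (char_entry (drop_variables A)) (Suc s) n = path_sum ?b (Suc s) n"
      using s by (intro path_sum_drop_variables[OF lay]; auto)+
    moreover have "path_sum ?b 0 s = monom 1 s" "path_sum ?b (Suc s) n = monom 1 (n - Suc s)"
      using bspec[OF iffD1[OF Q \<open>Q\<close>] one] s by auto
    ultimately have "char_poly (drop_variables A) = monom 1 n"
      using char_poly_zero_corner[OF drop_variables_carrier[OF carr] ULH_drop_variables[OF carr ulh] s(1) zero] s
      by (simp add: mult_monom)
    then have "char_poly A = companion_poly n"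
      using expansion \<open>Q\<close> by (simp add: companion_poly_def)
    then show ?thesis
      using char_poly_constant_part[OF carr] constant_term_companion_poly nil by simp
  qed
qed

theorem theorem3:
  fixes n :: nat
  assumes "1 \<le> n"
  shows
    "(\<forall>A :: 'a::field mpoly mat. companion_mat n A \<and> ULH A \<longrightarrow> A \<in> C_tilde_class) \<and>
     (\<forall>ix. \<forall>A :: 'a mpoly mat.
        valid_indices n ix \<and> A \<in> ULH_superpatterns (C_mat n ix) \<longrightarrow>
        (companion_mat n A \<longleftrightarrow>
           nilpotent_mat (constant_part A) \<and>
           (\<forall>k\<in>{1..n}. let B = principal_submatrix A 1 (ix k - k)
              in (constant_mat B \<and> nilpotent_mat B) \<or> empty_mat B) \<and>
           (\<forall>k\<in>{1..n}. let B = principal_submatrix A (ix k + 1) n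
              in (constant_mat B \<and> nilpotent_mat B) \<or> empty_mat B))) \<and>
     (\<forall>ix. \<forall>A :: 'a mpoly mat.
        valid_indices n ix \<and> A \<in> ULH_superpatterns (C_mat n ix) \<and>
        elements_mat (corner_block A (ix 1)) - {0} = mvar ` {1..n} \<longrightarrow>
        (companion_mat n A \<longleftrightarrow>
           (\<forall>k\<in>{1..n}. let B = principal_submatrix A 1 (ix k - k)
              in (constant_mat B \<and> nilpotent_mat B) \<or> empty_mat B) \<and>
           (\<forall>k\<in>{1..n}. let B = principal_submatrix A (ix k + 1) n
              in (constant_mat B \<and> nilpotent_mat B) \<or> empty_mat B)))"
proof (intro conjI allI impI)
  fix A :: "'a mpoly mat"
  assume "companion_mat n A \<and> ULH A"
  then show "A \<in> C_tilde_class" using companion_ULH_in_C_tilde_class assms by blast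
next
  fix ix and A :: "'a mpoly mat"
  assume "valid_indices n ix \<and> A \<in> ULH_superpatterns (C_mat n ix)"
  then show "companion_mat n A \<longleftrightarrow>
           nilpotent_mat (constant_part A) \<and>
           (\<forall>k\<in>{1..n}. let B = principal_submatrix A 1 (ix k - k)
              in (constant_mat B \<and> nilpotent_mat B) \<or> empty_mat B) \<and>
           (\<forall>k\<in>{1..n}. let B = principal_submatrix A (ix k + 1) n
              in (constant_mat B \<and> nilpotent_mat B) \<or> empty_mat B)"
    by (intro companion_iff_blocks(1)) auto
next
  fix ix and A :: "'a mpoly mat"
  assume "valid_indices n ix \<and> A \<in> ULH_superpatterns (C_mat n ix) \<and>
        elements_mat (corner_block A (ix 1)) - {0} = mvar ` {1..n}"
  then show "companion_mat n A \<longleftrightarrow>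
           (\<forall>k\<in>{1..n}. let B = principal_submatrix A 1 (ix k - k)
              in (constant_mat B \<and> nilpotent_mat B) \<or> empty_mat B) \<and>
           (\<forall>k\<in>{1..n}. let B = principal_submatrix A (ix k + 1) n
              in (constant_mat B \<and> nilpotent_mat B) \<or> empty_mat B)"
    using companion_iff_blocks[of n ix A] by blast
qed

end
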